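(* Let $M$ be a semi-invariant submanifold of a normal complex contact metric manifold $\bar M$. Then the invariant distribution $\mathcal D$ of $M$ is never involutive.
   Context: Complex contact metric manifolds. A complex contact manifold is a complex manifold $\bar M$ of complex dimension $2m+1$ with an open cover by coordinate neighborhoods $\mathcal U_i$ and holomorphic $1$-forms $\omega_i$ on $\mathcal U_i$ with $\omega_i\wedge(d\omega_i)^m\neq 0$ on $\mathcal U_i$ and $\omega_i=f_{ij}\omega_j$ on $\mathcal U_i\cap\mathcal U_j\ne\emptyset$ with $f_{ij}$ holomorphic. The kernels of the $\omega_i$ define the horizontal subbundle $\mathcal H\subset T\bar M$. Let $\bar J$ be the complex structure and $\bar g$ a Hermitian metric. A complex almost contact metric structure consists, on each $\mathcal U_i$ (index suppressed), of real $1$-forms $\bar u$, $\bar v=\bar u\circ \bar J$, with dual vector fields $\bar U$, $\bar V=-\bar J\bar U$, and $(1,1)$-tensor fields $\bar G$, $\bar H=\bar G\bar J$ such that $\bar G^2=\bar H^2=-I+\bar u\otimes\bar U+\bar v\otimes\bar V$, $\bar G\bar J=-\bar J\bar G$, $\bar G\bar U=0$, $\bar g(K,\bar GL)=-\bar g(\bar GK,L)$; on overlaps $u_j=cu_i-dv_i$, $v_j=du_i+cv_i$, $G_j=cG_i-dH_i$, $H_j=dG_i+cH_i$ for functions $c,d$ with $c^2+d^2=1$. Let $\bar\nabla$ be the Levi-Civita connection of $\bar g$ and $\bar\sigma(K)=\bar g(\bar\nabla_K\bar U,\bar V)$. $\bar M$ is a complex contact metric manifold if moreover $\mathcal H=\ker\bar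 u\cap\ker\bar v$ and $d\bar u(K,L)=\bar g(K,\bar GL)+(\bar\sigma\wedge\bar v)(K,L)$, $d\bar v(K,L)=\bar g(K,\bar HL)-(\bar\sigma\wedge\bar u)(K,L)$ (conventions $2d\alpha(K,L)=K\alpha(L)-L\alpha(K)-\alpha([K,L])$ and $2(\alpha\wedge\beta)(K,L)=\alpha(K)\beta(L)-\alpha(L)\beta(K)$). Normality (Korkmaz). For a $(1,1)$-tensor $F$ put $[F,F](K,L)=(\bar\nabla_{FK}F)L-(\bar\nabla_{FL}F)K-F(\bar\nabla_KF)L+F(\bar\nabla_LF)K$. Define $S(K,L)=[\bar G,\bar G](K,L)+2\bar g(K,\bar GL)\bar U-2\bar g(K,\bar HL)\bar V+2(\bar v(L)\bar HK-\bar v(K)\bar HL)+\bar\sigma(\bar GL)\bar HK-\bar\sigma(\bar GK)\bar HL+\bar\sigma(K)\bar G\bar HL-\bar\sigma(L)\bar G\bar HK$, $T(K,L)=[\bar H,\bar H](K,L)-2\bar g(K,\bar GL)\bar U+2\bar g(K,\bar HL)\bar V+2(\bar u(L)\bar GK-\bar u(K)\bar GL)+\bar\sigma(\bar HK)\bar GL-\bar\sigma(\bar HL)\bar GK+\bar\sigma(K)\bar G\bar HL-\bar\sigma(L)\bar G\bar HK$. $\bar M$ is normal if $S(K,L)=T(K,L)=0$ for all $K,L\in\mathcal H$ and $S(K,\bar U)=T(K,\bar V)=0$ for all $K$. Semi-invariant submanifolds. Let $M$ be a complex submanifold of the normal complex contact metric manifold $\bar M$ (real dimension $4m+2$), of real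 dimension $n+2$, with $\bar U,\bar V$ tangent to $M$. $M$ is semi-invariant if there are smooth distributions $\mathcal D,\mathcal D^{\bot}$ of constant rank on $M$, orthogonal to $sp\{\bar U,\bar V\}$ (the span of $\bar U,\bar V$), with $TM=\mathcal D\oplus\mathcal D^{\bot}\oplus sp\{\bar U,\bar V\}$ (orthogonal sum), $\bar G\mathcal D=\mathcal D$, $\bar H\mathcal D=\mathcal D$, $\bar G\mathcal D^{\bot}\subset TM^{\bot}$, $\bar H\mathcal D^{\bot}\subset TM^{\bot}$, where $TM^\bot$ is the normal bundle. $\mathcal D$ is called the invariant and $\mathcal D^{\bot}$ the anti-invariant distribution. (If $\dim\mathcal D=0$, $M$ is called an anti-invariant submanifold; if $\dim\mathcal D^{\bot}=0$, $M$ is called an invariant submanifold.)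
   Formalization: The invariant distribution D is assumed to have positive rank; when dim D = 0 (the anti-invariant case) D is the zero distribution, which is trivially involutive, so the claim fails there. *)

theory Defs
  imports "HOL-Analysis.Analysis" "HOL-Combinatorics.Permutations"
begin

section \<open>Smooth and holomorphic maps on open sets\<close>

text \<open>On an open set \<open>S\<close> this is continuous differentiability of order \<open>k\<close>:
  all iterated directional derivatives up to order \<open>k\<close> exist and are continuous.\<close>

primrec ck_on :: "nat \<Rightarrow> 'a::euclidean_space set \<Rightarrow> ('a \<Rightarrow> 'b::real_normed_vector) \<Rightarrow> bool" where
  "ck_on 0 S f \<longleftrightarrow> continuous_on S f"
| "ck_on (Suc k) S f \<longleftrightarrow> (\<forall>x\<in>S. f differentiable (at x)) \<and>
     (\<forall>v. ck_on k S (\<lambda>x. frechet_derivative f (at x) v))"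

definition smooth_on :: "'a::euclidean_space set \<Rightarrow> ('a \<Rightarrow> 'b::real_normed_vector) \<Rightarrow> bool" where
  "smooth_on S f \<longleftrightarrow> (\<forall>k. ck_on k S f)"

text \<open>Holomorphic functions of several complex variables, as smooth functions whose real
  differential is complex linear (the Cauchy-Riemann equations).\<close>

definition holo_on :: "(complex^'n) set \<Rightarrow> (complex^'n \<Rightarrow> complex) \<Rightarrow> bool" where
  "holo_on S f \<longleftrightarrow> smooth_on S f \<and>
     (\<forall>x\<in>S. \<forall>c v. frechet_derivative f (at x) (c *s v) = c * frechet_derivative f (at x) v)"

definition holo_map_on :: "(complex^'n) set \<Rightarrow> (complex^'n \<Rightarrow> complex^'k) \<Rightarrow> bool" where
  "holo_map_on S f \<longleftrightarrow> (\<forall>j. holo_on S (\<lambda>x. f x $ j))"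


section \<open>Charts, tangent spaces, vector fields\<close>

datatype ('p, 'e) chart = Chart (dom: "'p set") (coord: "'p \<Rightarrow> 'e")

definition chart_inv :: "('p, 'e) chart \<Rightarrow> 'e \<Rightarrow> 'p" where
  "chart_inv c = inv_into (dom c) (coord c)"

definition is_chart :: "('p::topological_space, 'e::euclidean_space) chart \<Rightarrow> bool" where
  "is_chart c \<longleftrightarrow> open (dom c) \<and> open (coord c ` dom c) \<and>
     homeomorphism (dom c) (coord c ` dom c) (coord c) (chart_inv c)"

text \<open>An atlas \<open>A\<close> is a set of charts. At each point \<open>p\<close> one chart of the atlas around \<open>p\<close> is
  singled out, and the tangent space at \<open>p\<close> is identified with the model space \<open>'e\<close> by the
  differential of that chart at \<open>p\<close>. So a tangent vector at \<open>p\<close> is an element of \<open>'e\<close>, a vector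
  field is a function \<open>'p \<Rightarrow> 'e\<close>, a tensor at \<open>p\<close> is a (multi)linear map on \<open>'e\<close>. The preferred
  charts at different points are unrelated; smoothness and derivatives are therefore always
  expressed through the components with respect to one chart, see \<open>components\<close>.\<close>

definition chart_at :: "('p, 'e) chart set \<Rightarrow> 'p \<Rightarrow> ('p, 'e) chart" where
  "chart_at A p = (SOME c. c \<in> A \<and> p \<in> dom c)"

text \<open>Components, with respect to the chart \<open>c\<close>, of the tangent vector \<open>v\<close> at \<open>p\<close>.\<close>

definition components ::
  "('p, 'e::euclidean_space) chart set \<Rightarrow> ('p, 'e) chart \<Rightarrow> 'p \<Rightarrow> 'e \<Rightarrow> 'e" where
  "components A c p v =
     frechet_derivative (coord c \<circ> chart_inv (chart_at A p)) (at (coord (chart_at A p) p)) v"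

definition smooth_fun ::
  "('p, 'e::euclidean_space) chart set \<Rightarrow> 'p set \<Rightarrow> ('p \<Rightarrow> 'b::real_normed_vector) \<Rightarrow> bool" where
  "smooth_fun A W h \<longleftrightarrow> (\<forall>c\<in>A. smooth_on (coord c ` (dom c \<inter> W)) (h \<circ> chart_inv c))"

definition field_rep ::
  "('p, 'e::euclidean_space) chart set \<Rightarrow> ('p, 'e) chart \<Rightarrow> ('p \<Rightarrow> 'e) \<Rightarrow> 'e \<Rightarrow> 'e" where
  "field_rep A c X x = components A c (chart_inv c x) (X (chart_inv c x))"

definition smooth_field ::
  "('p, 'e::euclidean_space) chart set \<Rightarrow> 'p set \<Rightarrow> ('p \<Rightarrow> 'e) \<Rightarrow> bool" where
  "smooth_field A W X \<longleftrightarrow> (\<forall>c\<in>A. smooth_on (coord c ` (dom c \<inter> W)) (field_rep A c X))"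

text \<open>The derivative of the function \<open>h\<close> at \<open>p\<close> in the direction of the tangent vector \<open>v\<close>.\<close>

definition dirderiv ::
  "('p, 'e::euclidean_space) chart set \<Rightarrow> ('p \<Rightarrow> 'b::real_normed_vector) \<Rightarrow> 'p \<Rightarrow> 'e \<Rightarrow> 'b" where
  "dirderiv A h p v =
     frechet_derivative (h \<circ> chart_inv (chart_at A p)) (at (coord (chart_at A p) p)) v"

text \<open>The Lie bracket at \<open>p\<close>, computed in the preferred chart at \<open>p\<close>: the \<open>j\<close>-th component is
  \<open>X(Y\<^sup>j) - Y(X\<^sup>j)\<close>.\<close>

definition lie_bracket ::
  "('p, 'e::euclidean_space) chart set \<Rightarrow> ('p \<Rightarrow> 'e) \<Rightarrow> ('p \<Rightarrow> 'e) \<Rightarrow> 'p \<Rightarrow> 'e" where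
  "lie_bracket A X Y p =
     (let c = chart_at A p in
        frechet_derivative (field_rep A c Y) (at (coord c p)) (X p)
      - frechet_derivative (field_rep A c X) (at (coord c p)) (Y p))"

text \<open>The differential at \<open>p\<close> of a map \<open>f\<close> between the manifolds with atlases \<open>B\<close> and \<open>A\<close>.\<close>

definition tangent_map ::
  "('q, 'd::euclidean_space) chart set \<Rightarrow> ('p, 'e::euclidean_space) chart set \<Rightarrow>
   ('q \<Rightarrow> 'p) \<Rightarrow> 'q \<Rightarrow> 'd \<Rightarrow> 'e" where
  "tangent_map B A f q v =
     frechet_derivative (coord (chart_at A (f q)) \<circ> f \<circ> chart_inv (chart_at B q))
       (at (coord (chart_at B q) q)) v"


section \<open>Forms, tensors and connections\<close>

text \<open>A field of linear maps, i.e. a 1-form (real or complex valued). Smoothness is tested on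
  local smooth vector fields.\<close>

definition smooth_form ::
  "('p::topological_space, 'e::euclidean_space) chart set \<Rightarrow> 'p set \<Rightarrow>
   ('p \<Rightarrow> 'e \<Rightarrow> 'b::real_normed_vector) \<Rightarrow> bool" where
  "smooth_form A U \<alpha> \<longleftrightarrow> (\<forall>p\<in>U. linear (\<alpha> p)) \<and>
     (\<forall>W X. open W \<and> W \<subseteq> U \<and> smooth_field A W X \<longrightarrow> smooth_fun A W (\<lambda>p. \<alpha> p (X p)))"

definition smooth_tensor11 ::
  "('p::topological_space, 'e::euclidean_space) chart set \<Rightarrow> 'p set \<Rightarrow>
   ('p \<Rightarrow> 'e \<Rightarrow> 'e) \<Rightarrow> bool" where
  "smooth_tensor11 A U F \<longleftrightarrow> (\<forall>p\<in>U. linear (F p)) \<and>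
     (\<forall>W X. open W \<and> W \<subseteq> U \<and> smooth_field A W X \<longrightarrow> smooth_field A W (\<lambda>p. F p (X p)))"

definition riemannian_metric ::
  "('p::topological_space, 'e::euclidean_space) chart set \<Rightarrow>
   ('p \<Rightarrow> 'e \<Rightarrow> 'e \<Rightarrow> real) \<Rightarrow> bool" where
  "riemannian_metric A g \<longleftrightarrow>
     (\<forall>p. bilinear (g p) \<and> (\<forall>k l. g p k l = g p l k) \<and> (\<forall>k. k \<noteq> 0 \<longrightarrow> g p k k > 0)) \<and>
     (\<forall>W X Y. open W \<and> smooth_field A W X \<and> smooth_field A W Y \<longrightarrow>
        smooth_fun A W (\<lambda>p. g p (X p) (Y p)))"

text \<open>Exterior derivative of a 1-form and wedge product of two 1-forms, normalised by
  \<open>2 d\<alpha>(K,L) = K \<alpha>(L) - L \<alpha>(K) - \<alpha>([K,L])\<close> and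
  \<open>2 (\<alpha> \<and> \<beta>)(K,L) = \<alpha>(K) \<beta>(L) - \<alpha>(L) \<beta>(K)\<close>.\<close>

definition ext_deriv ::
  "('p, 'e::euclidean_space) chart set \<Rightarrow> ('p \<Rightarrow> 'e \<Rightarrow> 'b::real_normed_vector) \<Rightarrow>
   ('p \<Rightarrow> 'e) \<Rightarrow> ('p \<Rightarrow> 'e) \<Rightarrow> 'p \<Rightarrow> 'b" where
  "ext_deriv A \<alpha> K L p =
     (1/2) *\<^sub>R (dirderiv A (\<lambda>q. \<alpha> q (L q)) p (K p) - dirderiv A (\<lambda>q. \<alpha> q (K q)) p (L p)
               - \<alpha> p (lie_bracket A K L p))"

definition wedge11 :: "('v \<Rightarrow> real) \<Rightarrow> ('v \<Rightarrow> real) \<Rightarrow> 'v \<Rightarrow> 'v \<Rightarrow> real" where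
  "wedge11 \<alpha> \<beta> k l = (\<alpha> k * \<beta> l - \<alpha> l * \<beta> k) / 2"

text \<open>Wedge product of a \<open>k\<close>-form with an \<open>l\<close>-form with the same normalisation. A \<open>k\<close>-form
  takes its arguments as a sequence, of which only the first \<open>k\<close> entries matter.\<close>

definition wedge ::
  "nat \<Rightarrow> nat \<Rightarrow> ((nat \<Rightarrow> 'v) \<Rightarrow> complex) \<Rightarrow> ((nat \<Rightarrow> 'v) \<Rightarrow> complex) \<Rightarrow> (nat \<Rightarrow> 'v) \<Rightarrow> complex" where
  "wedge k l \<alpha> \<beta> X =
     (\<Sum>\<pi> | \<pi> permutes {..<k+l}.
        of_int (sign \<pi>) * \<alpha> (\<lambda>j. X (\<pi> j)) * \<beta> (\<lambda>j. X (\<pi> (k + j)))) / fact (k + l)"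

primrec wedge_power ::
  "nat \<Rightarrow> ((nat \<Rightarrow> 'v) \<Rightarrow> complex) \<Rightarrow> nat \<Rightarrow> (nat \<Rightarrow> 'v) \<Rightarrow> complex" where
  "wedge_power k \<beta> 0 = (\<lambda>_. 1)"
| "wedge_power k \<beta> (Suc n) = wedge k (k * n) \<beta> (wedge_power k \<beta> n)"

text \<open>\<open>nabla Y p k\<close> is the covariant derivative at \<open>p\<close> of the field \<open>Y\<close> in the direction of the
  tangent vector \<open>k\<close>. Only fields that are smooth near \<open>p\<close> matter, and \<open>nabla Y p\<close> depends on the
  germ of \<open>Y\<close> at \<open>p\<close> only: take the indicator function of a neighbourhood of \<open>p\<close> for \<open>h\<close> in the
  Leibniz rule.\<close>

definition affine_connection ::
  "('p::topological_space, 'e::euclidean_space) chart set \<Rightarrow>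
   (('p \<Rightarrow> 'e) \<Rightarrow> 'p \<Rightarrow> 'e \<Rightarrow> 'e) \<Rightarrow> bool" where
  "affine_connection A nabla \<longleftrightarrow>
     (\<forall>W Y. open W \<and> smooth_field A W Y \<longrightarrow>
        smooth_tensor11 A W (nabla Y) \<and>
        (\<forall>Z. smooth_field A W Z \<longrightarrow>
           (\<forall>p\<in>W. \<forall>k. nabla (\<lambda>q. Y q + Z q) p k = nabla Y p k + nabla Z p k)) \<and>
        (\<forall>h :: 'p \<Rightarrow> real. smooth_fun A W h \<longrightarrow>
           (\<forall>p\<in>W. \<forall>k. nabla (\<lambda>q. h q *\<^sub>R Y q) p k =
              dirderiv A h p k *\<^sub>R Y p + h p *\<^sub>R nabla Y p k)))"

definition levi_civita ::
  "('p::topological_space, 'e::euclidean_space) chart set \<Rightarrow> ('p \<Rightarrow> 'e \<Rightarrow> 'e \<Rightarrow> real) \<Rightarrow>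
   (('p \<Rightarrow> 'e) \<Rightarrow> 'p \<Rightarrow> 'e \<Rightarrow> 'e) \<Rightarrow> bool" where
  "levi_civita A g nabla \<longleftrightarrow> affine_connection A nabla \<and>
     (\<forall>W X Y. open W \<and> smooth_field A W X \<and> smooth_field A W Y \<longrightarrow>
        (\<forall>p\<in>W. nabla Y p (X p) - nabla X p (Y p) = lie_bracket A X Y p) \<and>
        (\<forall>p\<in>W. \<forall>k. dirderiv A (\<lambda>q. g q (X q) (Y q)) p k =
           g p (nabla X p k) (Y p) + g p (X p) (nabla Y p k)))"

text \<open>\<open>cov_tensor nabla F L p k\<close> is \<open>(\<nabla>\<^sub>k F) L\<close> at \<open>p\<close>.\<close>

definition cov_tensor ::
  "(('p \<Rightarrow> 'e::euclidean_space) \<Rightarrow> 'p \<Rightarrow> 'e \<Rightarrow> 'e) \<Rightarrow> ('p \<Rightarrow> 'e \<Rightarrow> 'e) \<Rightarrow>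
   ('p \<Rightarrow> 'e) \<Rightarrow> 'p \<Rightarrow> 'e \<Rightarrow> 'e" where
  "cov_tensor nabla F L p k = nabla (\<lambda>q. F q (L q)) p k - F p (nabla L p k)"

definition nijenhuis ::
  "(('p \<Rightarrow> 'e::euclidean_space) \<Rightarrow> 'p \<Rightarrow> 'e \<Rightarrow> 'e) \<Rightarrow> ('p \<Rightarrow> 'e \<Rightarrow> 'e) \<Rightarrow>
   ('p \<Rightarrow> 'e) \<Rightarrow> ('p \<Rightarrow> 'e) \<Rightarrow> 'p \<Rightarrow> 'e" where
  "nijenhuis nabla F K L p =
     cov_tensor nabla F L p (F p (K p)) - cov_tensor nabla F K p (F p (L p))
     - F p (cov_tensor nabla F L p (K p)) + F p (cov_tensor nabla F K p (L p))"


section \<open>Distributions\<close>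

definition smooth_distribution ::
  "('q::topological_space, 'd::euclidean_space) chart set \<Rightarrow> nat \<Rightarrow> ('q \<Rightarrow> 'd set) \<Rightarrow> bool" where
  "smooth_distribution B r D \<longleftrightarrow>
     (\<forall>q. subspace (D q) \<and> dim (D q) = r) \<and>
     (\<forall>q. \<exists>W X. open W \<and> q \<in> W \<and> (\<forall>j<r. smooth_field B W (X j)) \<and>
        (\<forall>q'\<in>W. D q' = span ((\<lambda>j. X j q') ` {..<r})))"

definition involutive ::
  "('q::topological_space, 'd::euclidean_space) chart set \<Rightarrow> ('q \<Rightarrow> 'd set) \<Rightarrow> bool" where
  "involutive B D \<longleftrightarrow>
     (\<forall>W X Y. open W \<and> smooth_field B W X \<and> smooth_field B W Y \<and>
        (\<forall>q\<in>W. X q \<in> D q \<and> Y q \<in> D q) \<longrightarrow> (\<forall>q\<in>W. lie_bracket B X Y q \<in> D q))"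


section \<open>Complex manifolds\<close>

definition holo_compatible ::
  "('p, complex^'n) chart \<Rightarrow> ('p, complex^'n) chart \<Rightarrow> bool" where
  "holo_compatible c d \<longleftrightarrow>
     holo_map_on (coord c ` (dom c \<inter> dom d)) (coord d \<circ> chart_inv c) \<and>
     holo_map_on (coord d ` (dom c \<inter> dom d)) (coord c \<circ> chart_inv d)"

locale complex_manifold =
  fixes A :: "('p::{t2_space, second_countable_topology}, complex^'n) chart set"
  assumes charts: "\<And>c. c \<in> A \<Longrightarrow> is_chart c"
    and charts_cover: "(\<Union>c\<in>A. dom c) = UNIV"
    and charts_compatible: "\<And>c d. c \<in> A \<Longrightarrow> d \<in> A \<Longrightarrow> holo_compatible c d"

text \<open>Since the coordinate changes are holomorphic, the complex structure on each tangent space is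
  multiplication by \<open>\<i>\<close> on the model space.\<close>

definition cplx_J :: "complex^'n \<Rightarrow> complex^'n" where
  "cplx_J k = \<i> *s k"

definition holo_fun ::
  "('p, complex^'n) chart set \<Rightarrow> 'p set \<Rightarrow> ('p \<Rightarrow> complex) \<Rightarrow> bool" where
  "holo_fun A W h \<longleftrightarrow> (\<forall>c\<in>A. holo_on (coord c ` (dom c \<inter> W)) (h \<circ> chart_inv c))"

definition holo_field ::
  "('p, complex^'n) chart set \<Rightarrow> 'p set \<Rightarrow> ('p \<Rightarrow> complex^'n) \<Rightarrow> bool" where
  "holo_field A W X \<longleftrightarrow> (\<forall>c\<in>A. holo_map_on (coord c ` (dom c \<inter> W)) (field_rep A c X))"

definition holo_form ::
  "('p::topological_space, complex^'n) chart set \<Rightarrow> 'p set \<Rightarrow>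
   ('p \<Rightarrow> complex^'n \<Rightarrow> complex) \<Rightarrow> bool" where
  "holo_form A U \<omega> \<longleftrightarrow>
     (\<forall>p\<in>U. linear (\<omega> p) \<and> (\<forall>c k. \<omega> p (c *s k) = c * \<omega> p k)) \<and>
     (\<forall>W X. open W \<and> W \<subseteq> U \<and> holo_field A W X \<longrightarrow> holo_fun A W (\<lambda>p. \<omega> p (X p)))"

definition hermitian_metric ::
  "('p::topological_space, complex^'n) chart set \<Rightarrow>
   ('p \<Rightarrow> complex^'n \<Rightarrow> complex^'n \<Rightarrow> real) \<Rightarrow> bool" where
  "hermitian_metric A g \<longleftrightarrow> riemannian_metric A g \<and>
     (\<forall>p k l. g p (cplx_J k) (cplx_J l) = g p k l)"

text \<open>Complex submanifolds are given by injective holomorphic immersions; this includes the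
  embedded ones.\<close>

locale complex_submanifold =
  sub: complex_manifold B + ambient: complex_manifold A
  for B :: "('q::{t2_space, second_countable_topology}, complex^'k) chart set"
    and A :: "('p::{t2_space, second_countable_topology}, complex^'n) chart set" +
  fixes f :: "'q \<Rightarrow> 'p"
  assumes f_continuous: "continuous_on UNIV f"
    and f_holomorphic: "\<And>b a. b \<in> B \<Longrightarrow> a \<in> A \<Longrightarrow>
      holo_map_on (coord b ` (dom b \<inter> f -` dom a)) (coord a \<circ> f \<circ> chart_inv b)"
    and f_immersion: "\<And>q. inj (tangent_map B A f q)"
    and f_inj: "inj f"


section \<open>Complex contact metric manifolds\<close>

text \<open>The form \<open>\<omega> \<and> (d\<omega>)\<^sup>m\<close> at \<open>p\<close>, evaluated on the values at \<open>p\<close> of the fields \<open>X 0, \<dots>, X (2m)\<close>,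
  which are to be smooth near \<open>p\<close>.\<close>

definition contact_volume ::
  "('p, complex^'n) chart set \<Rightarrow> nat \<Rightarrow> ('p \<Rightarrow> complex^'n \<Rightarrow> complex) \<Rightarrow> 'p \<Rightarrow>
   (nat \<Rightarrow> 'p \<Rightarrow> complex^'n) \<Rightarrow> complex" where
  "contact_volume A m \<omega> p =
     wedge 1 (2 * m) (\<lambda>X. \<omega> p (X 0 p))
       (wedge_power 2 (\<lambda>X. ext_deriv A \<omega> (X 0) (X 1) p) m)"

locale complex_contact_manifold = complex_manifold A
  for A :: "('p::{t2_space, second_countable_topology}, complex^'n) chart set" +
  fixes m :: nat
    and \<U> :: "'i \<Rightarrow> 'p set"
    and \<omega> :: "'i \<Rightarrow> 'p \<Rightarrow> complex^'n \<Rightarrow> complex"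
  assumes dimension: "CARD('n) = 2 * m + 1"
    and \<U>_coordinate: "\<And>i. \<exists>c. is_chart c \<and> dom c = \<U> i \<and> (\<forall>a\<in>A. holo_compatible c a)"
    and \<U>_cover: "(\<Union>i. \<U> i) = UNIV"
    and \<omega>_holomorphic: "\<And>i. holo_form A (\<U> i) (\<omega> i)"
    and \<omega>_contact: "\<And>i p. p \<in> \<U> i \<Longrightarrow>
      \<exists>W X. open W \<and> p \<in> W \<and> (\<forall>j. smooth_field A W (X j)) \<and> contact_volume A m (\<omega> i) p X \<noteq> 0"
    and \<omega>_overlap: "\<And>i j. \<U> i \<inter> \<U> j \<noteq> {} \<Longrightarrow>
      \<exists>h. holo_fun A (\<U> i \<inter> \<U> j) h \<and> (\<forall>p\<in>\<U> i \<inter> \<U> j. \<forall>k. \<omega> i p k = h p * \<omega> j p k)"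
begin

definition horizontal :: "'p \<Rightarrow> (complex^'n) set" where
  "horizontal p = {k. \<forall>i. p \<in> \<U> i \<longrightarrow> \<omega> i p k = 0}"

end

text \<open>The local tensors of a complex almost contact metric structure; the index \<open>i\<close> is that of the
  neighbourhood \<open>\<U> i\<close>. The arguments \<open>K\<close> and \<open>L\<close> of \<open>S\<close> and \<open>T\<close> are vector fields,
  that of \<open>\<sigma>\<close> is a tangent vector.\<close>

locale contact_tensors =
  fixes g :: "'p \<Rightarrow> complex^'n \<Rightarrow> complex^'n \<Rightarrow> real"
    and nabla :: "('p \<Rightarrow> complex^'n) \<Rightarrow> 'p \<Rightarrow> complex^'n \<Rightarrow> complex^'n"
    and u :: "'i \<Rightarrow> 'p \<Rightarrow> complex^'n \<Rightarrow> real"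
    and U :: "'i \<Rightarrow> 'p \<Rightarrow> complex^'n"
    and G :: "'i \<Rightarrow> 'p \<Rightarrow> complex^'n \<Rightarrow> complex^'n"
begin

definition v :: "'i \<Rightarrow> 'p \<Rightarrow> complex^'n \<Rightarrow> real" where
  "v i p k = u i p (cplx_J k)"

definition V :: "'i \<Rightarrow> 'p \<Rightarrow> complex^'n" where
  "V i p = - cplx_J (U i p)"

definition H :: "'i \<Rightarrow> 'p \<Rightarrow> complex^'n \<Rightarrow> complex^'n" where
  "H i p k = G i p (cplx_J k)"

definition \<sigma> :: "'i \<Rightarrow> 'p \<Rightarrow> complex^'n \<Rightarrow> real" where
  "\<sigma> i p k = g p (nabla (U i) p k) (V i p)"

definition S :: "'i \<Rightarrow> ('p \<Rightarrow> complex^'n) \<Rightarrow> ('p \<Rightarrow> complex^'n) \<Rightarrow> 'p \<Rightarrow> complex^'n" where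
  "S i K L p = (let k = K p; l = L p in
     nijenhuis nabla (G i) K L p
     + (2 * g p k (G i p l)) *\<^sub>R U i p - (2 * g p k (H i p l)) *\<^sub>R V i p
     + 2 *\<^sub>R (v i p l *\<^sub>R H i p k - v i p k *\<^sub>R H i p l)
     + \<sigma> i p (G i p l) *\<^sub>R H i p k - \<sigma> i p (G i p k) *\<^sub>R H i p l
     + \<sigma> i p k *\<^sub>R G i p (H i p l) - \<sigma> i p l *\<^sub>R G i p (H i p k))"

definition T :: "'i \<Rightarrow> ('p \<Rightarrow> complex^'n) \<Rightarrow> ('p \<Rightarrow> complex^'n) \<Rightarrow> 'p \<Rightarrow> complex^'n" where
  "T i K L p = (let k = K p; l = L p in
     nijenhuis nabla (H i) K L p
     - (2 * g p k (G i p l)) *\<^sub>R U i p + (2 * g p k (H i p l)) *\<^sub>R V i p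
     + 2 *\<^sub>R (u i p l *\<^sub>R G i p k - u i p k *\<^sub>R G i p l)
     + \<sigma> i p (H i p k) *\<^sub>R G i p l - \<sigma> i p (H i p l) *\<^sub>R G i p k
     + \<sigma> i p k *\<^sub>R G i p (H i p l) - \<sigma> i p l *\<^sub>R G i p (H i p k))"

end

text \<open>In \<open>metric_dual\<close>, \<open>U\<close> is the metric dual of \<open>u\<close>; then \<open>V\<close> is that of \<open>v\<close>.\<close>

locale complex_almost_contact_metric_manifold =
  complex_contact_manifold A m \<U> \<omega> + contact_tensors g nabla u U G
  for A :: "('p::{t2_space, second_countable_topology}, complex^'n) chart set"
    and m :: nat
    and \<U> :: "'i \<Rightarrow> 'p set"
    and \<omega> :: "'i \<Rightarrow> 'p \<Rightarrow> complex^'n \<Rightarrow> complex"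
    and g :: "'p \<Rightarrow> complex^'n \<Rightarrow> complex^'n \<Rightarrow> real"
    and nabla :: "('p \<Rightarrow> complex^'n) \<Rightarrow> 'p \<Rightarrow> complex^'n \<Rightarrow> complex^'n"
    and u :: "'i \<Rightarrow> 'p \<Rightarrow> complex^'n \<Rightarrow> real"
    and U :: "'i \<Rightarrow> 'p \<Rightarrow> complex^'n"
    and G :: "'i \<Rightarrow> 'p \<Rightarrow> complex^'n \<Rightarrow> complex^'n" +
  assumes hermitian: "hermitian_metric A g"
    and nabla_levi_civita: "levi_civita A g nabla"
    and u_smooth: "\<And>i. smooth_form A (\<U> i) (u i)"
    and U_smooth: "\<And>i. smooth_field A (\<U> i) (U i)"
    and G_smooth: "\<And>i. smooth_tensor11 A (\<U> i) (G i)"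
    and metric_dual: "\<And>i p k. p \<in> \<U> i \<Longrightarrow> u i p k = g p k (U i p)"
    and G_square: "\<And>i p k. p \<in> \<U> i \<Longrightarrow>
      G i p (G i p k) = - k + u i p k *\<^sub>R U i p + v i p k *\<^sub>R V i p"
    and H_square: "\<And>i p k. p \<in> \<U> i \<Longrightarrow>
      H i p (H i p k) = - k + u i p k *\<^sub>R U i p + v i p k *\<^sub>R V i p"
    and G_J: "\<And>i p k. p \<in> \<U> i \<Longrightarrow> G i p (cplx_J k) = - cplx_J (G i p k)"
    and G_U: "\<And>i p. p \<in> \<U> i \<Longrightarrow> G i p (U i p) = 0"
    and G_skew: "\<And>i p k l. p \<in> \<U> i \<Longrightarrow> g p k (G i p l) = - g p (G i p k) l"
    and overlap: "\<And>i j. \<exists>c d :: 'p \<Rightarrow> real. \<forall>p\<in>\<U> i \<inter> \<U> j.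
      (c p)\<^sup>2 + (d p)\<^sup>2 = 1 \<and>
      (\<forall>k. u j p k = c p * u i p k - d p * v i p k \<and>
           v j p k = d p * u i p k + c p * v i p k \<and>
           G j p k = c p *\<^sub>R G i p k - d p *\<^sub>R H i p k \<and>
           H j p k = d p *\<^sub>R G i p k + c p *\<^sub>R H i p k)"

locale complex_contact_metric_manifold = complex_almost_contact_metric_manifold +
  assumes horizontal_kernel: "\<And>i p. p \<in> \<U> i \<Longrightarrow> horizontal p = {k. u i p k = 0 \<and> v i p k = 0}"
    and du: "\<And>i W K L p. open W \<Longrightarrow> W \<subseteq> \<U> i \<Longrightarrow> smooth_field A W K \<Longrightarrow> smooth_field A W L \<Longrightarrow>
      p \<in> W \<Longrightarrow>
      ext_deriv A (u i) K L p = g p (K p) (G i p (L p)) + wedge11 (\<sigma> i p) (v i p) (K p) (L p)"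
    and dv: "\<And>i W K L p. open W \<Longrightarrow> W \<subseteq> \<U> i \<Longrightarrow> smooth_field A W K \<Longrightarrow> smooth_field A W L \<Longrightarrow>
      p \<in> W \<Longrightarrow>
      ext_deriv A (v i) K L p = g p (K p) (H i p (L p)) - wedge11 (\<sigma> i p) (u i p) (K p) (L p)"

locale normal_complex_contact_metric_manifold = complex_contact_metric_manifold +
  assumes normal_horizontal: "\<And>i W K L p. open W \<Longrightarrow> W \<subseteq> \<U> i \<Longrightarrow>
      smooth_field A W K \<Longrightarrow> smooth_field A W L \<Longrightarrow>
      (\<And>q. q \<in> W \<Longrightarrow> K q \<in> horizontal q \<and> L q \<in> horizontal q) \<Longrightarrow> p \<in> W \<Longrightarrow>
      S i K L p = 0 \<and> T i K L p = 0"
    and normal_vertical: "\<And>i W K p. open W \<Longrightarrow> W \<subseteq> \<U> i \<Longrightarrow> smooth_field A W K \<Longrightarrow> p \<in> W \<Longrightarrow>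
      S i K (U i) p = 0 \<and> T i K (V i) p = 0"


section \<open>Semi-invariant submanifolds\<close>

text \<open>The tangent and normal spaces of the submanifold \<open>f\<close> at \<open>q\<close>, as subspaces of the ambient
  tangent space at \<open>f q\<close>.\<close>

definition tangent_space ::
  "('q, 'd::euclidean_space) chart set \<Rightarrow> ('p, 'e::euclidean_space) chart set \<Rightarrow>
   ('q \<Rightarrow> 'p) \<Rightarrow> 'q \<Rightarrow> 'e set" where
  "tangent_space B A f q = range (tangent_map B A f q)"

definition push_distribution ::
  "('q, 'd::euclidean_space) chart set \<Rightarrow> ('p, 'e::euclidean_space) chart set \<Rightarrow>
   ('q \<Rightarrow> 'p) \<Rightarrow> ('q \<Rightarrow> 'd set) \<Rightarrow> 'q \<Rightarrow> 'e set" where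
  "push_distribution B A f D q = tangent_map B A f q ` D q"

definition normal_space ::
  "('q, 'd::euclidean_space) chart set \<Rightarrow> ('p, 'e::euclidean_space) chart set \<Rightarrow>
   ('p \<Rightarrow> 'e \<Rightarrow> 'e \<Rightarrow> real) \<Rightarrow> ('q \<Rightarrow> 'p) \<Rightarrow> 'q \<Rightarrow> 'e set" where
  "normal_space B A g f q = {w. \<forall>t\<in>tangent_space B A f q. g (f q) w t = 0}"

text \<open>The submanifold is \<open>f : M \<rightarrow> M\<^sub>0\<close>, with atlases \<open>B\<close> and \<open>A\<close>. The distributions \<open>D\<close> and \<open>D'\<close> (the
  anti-invariant one) are given on \<open>M\<close>; the conditions compare their images under the differential
  of \<open>f\<close> inside the tangent spaces of \<open>M\<^sub>0\<close>.\<close>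

locale semi_invariant_submanifold =
  normal_complex_contact_metric_manifold A m \<U> \<omega> g nabla u U G + complex_submanifold B A f
  for A :: "('p::{t2_space, second_countable_topology}, complex^'n) chart set"
    and m :: nat
    and \<U> :: "'i \<Rightarrow> 'p set"
    and \<omega> :: "'i \<Rightarrow> 'p \<Rightarrow> complex^'n \<Rightarrow> complex"
    and g :: "'p \<Rightarrow> complex^'n \<Rightarrow> complex^'n \<Rightarrow> real"
    and nabla :: "('p \<Rightarrow> complex^'n) \<Rightarrow> 'p \<Rightarrow> complex^'n \<Rightarrow> complex^'n"
    and u :: "'i \<Rightarrow> 'p \<Rightarrow> complex^'n \<Rightarrow> real"
    and U :: "'i \<Rightarrow> 'p \<Rightarrow> complex^'n"
    and G :: "'i \<Rightarrow> 'p \<Rightarrow> complex^'n \<Rightarrow> complex^'n"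
    and B :: "('q::{t2_space, second_countable_topology}, complex^'k) chart set"
    and f :: "'q \<Rightarrow> 'p" +
  fixes D D' :: "'q \<Rightarrow> (complex^'k) set"
  assumes UV_tangent: "\<And>i q. f q \<in> \<U> i \<Longrightarrow>
      U i (f q) \<in> tangent_space B A f q \<and> V i (f q) \<in> tangent_space B A f q"
    and D_distribution: "\<exists>r. smooth_distribution B r D"
    and D'_distribution: "\<exists>r. smooth_distribution B r D'"
    and tangent_sum: "\<And>i q. f q \<in> \<U> i \<Longrightarrow>
      tangent_space B A f q =
        {x + y + z | x y z. x \<in> push_distribution B A f D q \<and> y \<in> push_distribution B A f D' q \<and>
           z \<in> span {U i (f q), V i (f q)}}"
    and orthogonal_UV: "\<And>i q x z. f q \<in> \<U> i \<Longrightarrow>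
      x \<in> push_distribution B A f D q \<union> push_distribution B A f D' q \<Longrightarrow>
      z \<in> span {U i (f q), V i (f q)} \<Longrightarrow> g (f q) x z = 0"
    and orthogonal_DD': "\<And>q x y. x \<in> push_distribution B A f D q \<Longrightarrow>
      y \<in> push_distribution B A f D' q \<Longrightarrow> g (f q) x y = 0"
    and D_invariant: "\<And>i q. f q \<in> \<U> i \<Longrightarrow>
      G i (f q) ` push_distribution B A f D q = push_distribution B A f D q \<and>
      H i (f q) ` push_distribution B A f D q = push_distribution B A f D q"
    and D'_anti_invariant: "\<And>i q. f q \<in> \<U> i \<Longrightarrow>
      G i (f q) ` push_distribution B A f D' q \<subseteq> normal_space B A g f q \<and>
      H i (f q) ` push_distribution B A f D' q \<subseteq> normal_space B A g f q"

end

theory Submission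
  imports Defs
begin

text \<open>The local 1-form \<open>u\<close> vanishes on \<open>\<D>\<close>, and so does its pullback to \<open>M\<close>. If \<open>\<D>\<close> were involutive, then
  \<open>du(X,Y) = - u([X,Y]) / 2 = 0\<close> for all \<open>X, Y\<close> in \<open>\<D>\<close>. But \<open>du(X,Y) = g(X,GY)\<close> on horizontal vectors, and for
  \<open>Y = GX\<close>, which is again in \<open>\<D>\<close>, this is \<open>g(X,G\<^sup>2X) = - g(X,X)\<close>. To compare \<open>du\<close>, which is evaluated on
  fields of the ambient manifold, with brackets on \<open>M\<close>, we use that \<open>d\<close> commutes with pullbacks.\<close>

section \<open>Calculus of smooth maps\<close>

text \<open>The formula for du concerns fields on open subsets of the ambient manifold, involutivity
  concerns fields on M, and the image of a field under the differential of \<open>f\<close> lives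
  only along \<open>f\<close>. Instead of extending such images, the proof works at a single point:
  there d of a 1-form depends on two tangent vectors only, so ambient fields with constant
  components in a chart can stand in. What makes the two exterior derivatives agree is the symmetry
  of second derivatives, derived here for \<open>smooth_on\<close> from second differences. Tangent
  vectors at different points are expressed in unrelated preferred charts, so each derivative must
  be moved to one fixed chart before it can be computed; this is why the chart part is long. The
  vectors in D are horizontal because D is orthogonal to both U and V: v vanishes on D as well as u,
  which removes the wedge term of du and reduces \<open>G\<^sup>2\<close> to minus the identity. The
  result is pointwise: each vector of D is zero, by positivity of the metric and injectivity of the
  differential of \<open>f\<close>, and positive dimension of D rules this out.\<close>

lemma frechet_derivative_cong_open:
  assumes "open S" "x \<in> S" "\<And>y. y \<in> S \<Longrightarrow> f y = g y"
  shows "frechet_derivative f (at x) = frechet_derivative g (at x)"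
proof -
  \<comment> \<open>\<open>frechet_derivative\<close> is a choice among all derivatives, so it
    suffices that both functions have the same ones; this also covers points where there are
    none.\<close>
  have "(f has_derivative D) (at x) \<longleftrightarrow> (g has_derivative D) (at x)" for D
    using assms has_derivative_transform_within_open[of f D x UNIV S g]
      has_derivative_transform_within_open[of g D x UNIV S f] by auto
  then show ?thesis by (simp add: frechet_derivative_def)
qed

lemma differentiable_cong_open:
  assumes "open S" "x \<in> S" "\<And>y. y \<in> S \<Longrightarrow> f y = g y" "f differentiable (at x)"
  shows "g differentiable (at x)"
proof -
  obtain D where "(f has_derivative D) (at x)" using assms(4) by (auto simp: differentiable_def)
  then have "(g has_derivative D) (at x)"
    using has_derivative_transform_within_open[of f D x UNIV S g] assms(1-3) by simp
  then show ?thesis by (rule differentiableI)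
qed

lemma has_derivative_frechet:
  "f differentiable (at x) \<Longrightarrow> (f has_derivative frechet_derivative f (at x)) (at x)"
  by (simp add: frechet_derivative_works)

lemma has_derivative_at_compose:
  assumes "(g has_derivative g') (at x)" "(f has_derivative f') (at (g x))"
  shows "((\<lambda>x. f (g x)) has_derivative (\<lambda>v. f' (g' v))) (at x)"
  using diff_chain_at[OF assms] by (simp add: o_def)

lemma frechet_derivative_chain:
  assumes "g differentiable (at x)" "f differentiable (at (g x))"
  shows "frechet_derivative (\<lambda>x. f (g x)) (at x) v =
    frechet_derivative f (at (g x)) (frechet_derivative g (at x) v)"
  using frechet_derivative_at[OF has_derivative_at_compose[OF
      assms(1)[THEN has_derivative_frechet] assms(2)[THEN has_derivative_frechet]], symmetric]
  by simp

text \<open>\<open>ck_on\<close> controls derivatives in fixed directions only. The expansion turns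
  a direction that moves with the point into real coefficients times fixed directions.\<close>

lemma linear_expand_Basis:
  fixes f :: "'a::euclidean_space \<Rightarrow> 'b::real_normed_vector"
  assumes "linear L"
  shows "L (w :: 'a) = (\<Sum>b\<in>Basis. (w \<bullet> b) *\<^sub>R (L b :: 'b))"
proof -
  have "L w = L (\<Sum>b\<in>Basis. (w \<bullet> b) *\<^sub>R b)" by (simp add: euclidean_representation)
  also have "\<dots> = (\<Sum>b\<in>Basis. (w \<bullet> b) *\<^sub>R L b)" by (simp only: linear_sum[OF assms] linear_scale[OF assms])
  finally show ?thesis .
qed

section \<open>Closure properties of maps of class \<open>C\<^sup>k\<close> and of smooth
  maps\<close>

lemma ck_on_cong:
  assumes "open S" "\<And>x. x \<in> S \<Longrightarrow> f x = g x" "ck_on k S f"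
  shows "ck_on k S g"
  using assms(2,3)
proof (induction k arbitrary: f g)
  case 0
  then show ?case by (simp cong: continuous_on_cong)
next
  case (Suc k)
  have "frechet_derivative f (at x) = frechet_derivative g (at x)" if "x \<in> S" for x
    using frechet_derivative_cong_open[OF assms(1) that Suc.prems(1)] .
  then have "ck_on k S (\<lambda>x. frechet_derivative g (at x) v)" for v
    using Suc.IH[of "\<lambda>x. frechet_derivative f (at x) v" "\<lambda>x. frechet_derivative g (at x) v"]
      Suc.prems by simp
  then show ?case
    using Suc.prems differentiable_cong_open[OF assms(1) _ Suc.prems(1)] by simp
qed

lemma ck_on_Suc_D: "ck_on (Suc k) S f \<Longrightarrow> ck_on k S f"
proof (induction k arbitrary: f)
  case 0
  then show ?case
    by (auto intro!: continuous_at_imp_continuous_on differentiable_imp_continuous_within)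
next
  case (Suc k)
  then show ?case by auto
qed

lemma ck_on_subset: "ck_on k S f \<Longrightarrow> R \<subseteq> S \<Longrightarrow> ck_on k R f"
proof (induction k arbitrary: f)
  case 0
  then show ?case by (auto intro: continuous_on_subset)
next
  case (Suc k)
  then show ?case by auto
qed

lemma ck_on_const: "ck_on k S (\<lambda>x. c)"
  by (induction k arbitrary: c) auto

lemma ck_on_bounded_linear:
  assumes "open S" "bounded_linear L" "ck_on k S f"
  shows "ck_on k S (\<lambda>x. L (f x))"
  using assms(3)
proof (induction k arbitrary: f)
  case 0
  then show ?case by (simp add: bounded_linear.continuous_on[OF assms(2)])
next
  case (Suc k)
  have D: "((\<lambda>x. L (f x)) has_derivative (\<lambda>v. L (frechet_derivative f (at x) v))) (at x)"
    if "x \<in> S" for x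
    by (rule bounded_linear.has_derivative[OF assms(2) has_derivative_frechet])
      (use Suc.prems that in simp)
  have "ck_on k S (\<lambda>x. frechet_derivative (\<lambda>x. L (f x)) (at x) v)" for v
    by (rule ck_on_cong[OF assms(1), of "\<lambda>x. L (frechet_derivative f (at x) v)"])
      (use Suc in \<open>auto simp: frechet_derivative_at[OF D, symmetric]\<close>)
  then show ?case using D by (auto simp: differentiable_def)
qed

lemma ck_on_add:
  assumes "open S" "ck_on k S f" "ck_on k S g"
  shows "ck_on k S (\<lambda>x. f x + g x)"
  using assms(2,3)
proof (induction k arbitrary: f g)
  case 0
  then show ?case by (simp add: continuous_on_add)
next
  case (Suc k)
  have D: "((\<lambda>x. f x + g x) has_derivative
      (\<lambda>v. frechet_derivative f (at x) v + frechet_derivative g (at x) v)) (at x)"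
    if "x \<in> S" for x
    using Suc.prems that by (intro has_derivative_add has_derivative_frechet) auto
  have "ck_on k S (\<lambda>x. frechet_derivative (\<lambda>x. f x + g x) (at x) v)" for v
    by (rule ck_on_cong[OF assms(1), of "\<lambda>x. frechet_derivative f (at x) v + frechet_derivative g (at x) v"])
      (use Suc in \<open>auto simp: frechet_derivative_at[OF D, symmetric]\<close>)
  then show ?case using D by (auto simp: differentiable_def)
qed

lemma ck_on_sum:
  assumes "open S" "\<And>i. i \<in> I \<Longrightarrow> ck_on k S (f i)"
  shows "ck_on k S (\<lambda>x. \<Sum>i\<in>I. f i x)"
  using assms(2)
  by (induction I rule: infinite_finite_induct) (simp_all add: ck_on_const ck_on_add[OF assms(1)])

lemma ck_on_scaleR:
  fixes f :: "'a::euclidean_space \<Rightarrow> real" and g :: "'a \<Rightarrow> 'b::real_normed_vector"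
  assumes "open S" "ck_on k S f" "ck_on k S g"
  shows "ck_on k S (\<lambda>x. f x *\<^sub>R g x)"
  using assms(2,3)
proof (induction k arbitrary: f g)
  case 0
  then show ?case by (simp add: continuous_on_scaleR)
next
  case (Suc k)
  have D: "((\<lambda>x. f x *\<^sub>R g x) has_derivative
      (\<lambda>v. f x *\<^sub>R frechet_derivative g (at x) v + frechet_derivative f (at x) v *\<^sub>R g x)) (at x)"
    if "x \<in> S" for x
    using Suc.prems that by (intro has_derivative_scaleR has_derivative_frechet) auto
  have "ck_on k S (\<lambda>x. frechet_derivative (\<lambda>x. f x *\<^sub>R g x) (at x) v)" for v
  proof (rule ck_on_cong[OF assms(1)])
    show "ck_on k S (\<lambda>x. f x *\<^sub>R frechet_derivative g (at x) v + frechet_derivative f (at x) v *\<^sub>R g x)"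
      using Suc.prems ck_on_Suc_D[OF Suc.prems(1)] ck_on_Suc_D[OF Suc.prems(2)]
      by (intro ck_on_add[OF assms(1)] Suc.IH) auto
  qed (auto simp: frechet_derivative_at[OF D, symmetric])
  then show ?case using D by (auto simp: differentiable_def)
qed

text \<open>Induction on the order with \<open>g\<close> fixed and \<open>f\<close> arbitrary. In
  the chain rule the differential of \<open>f\<close> is applied to a moving direction; after
  expansion in \<open>Basis\<close> each term is a real function of lower order times the
  composition of \<open>g\<close> with a directional derivative of \<open>f\<close>, and the
  induction hypothesis covers the latter.\<close>

lemma ck_on_compose:
  fixes g :: "'a::euclidean_space \<Rightarrow> 'b::euclidean_space" and f :: "'b \<Rightarrow> 'c::real_normed_vector"
  assumes "open S" "g ` S \<subseteq> R" "ck_on k S g" "ck_on k R f"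
  shows "ck_on k S (\<lambda>x. f (g x))"
  using assms(3,4)
proof (induction k arbitrary: f)
  case 0
  then show ?case using assms(2) by (auto intro: continuous_on_compose2)
next
  case (Suc k)
  have diff: "g differentiable (at x)" "f differentiable (at (g x))" if "x \<in> S" for x
    using Suc.prems that assms(2) by auto
  have "ck_on k S (\<lambda>x. frechet_derivative (\<lambda>x. f (g x)) (at x) v)" for v
  proof (rule ck_on_cong[OF assms(1)])
    show "ck_on k S (\<lambda>x. \<Sum>b\<in>Basis. (frechet_derivative g (at x) v \<bullet> b) *\<^sub>R
        frechet_derivative f (at (g x)) b)"
      using Suc.prems ck_on_Suc_D[OF Suc.prems(1)]
      by (intro ck_on_sum[OF assms(1)] ck_on_scaleR[OF assms(1)]
          ck_on_bounded_linear[OF assms(1) bounded_linear_inner_left] Suc.IH) auto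
    show "(\<Sum>b\<in>Basis. (frechet_derivative g (at x) v \<bullet> b) *\<^sub>R frechet_derivative f (at (g x)) b)
        = frechet_derivative (\<lambda>x. f (g x)) (at x) v" if "x \<in> S" for x
      by (simp only: frechet_derivative_chain[OF diff[OF that]]
          linear_expand_Basis[OF linear_frechet_derivative[OF diff(2)[OF that]], symmetric])
  qed
  then show ?case
    using has_derivative_at_compose[OF diff[THEN has_derivative_frechet]] by (auto simp: differentiable_def)
qed

lemma smooth_on_cong:
  "open S \<Longrightarrow> (\<And>x. x \<in> S \<Longrightarrow> f x = g x) \<Longrightarrow> smooth_on S f \<Longrightarrow> smooth_on S g"
  by (simp add: smooth_on_def ck_on_cong[of S f g])

lemma smooth_on_subset: "smooth_on S f \<Longrightarrow> R \<subseteq> S \<Longrightarrow> smooth_on R f"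
  by (simp add: smooth_on_def ck_on_subset[of _ S f R])

lemma smooth_on_const: "smooth_on S (\<lambda>x. c)"
  by (simp add: smooth_on_def ck_on_const)

lemma smooth_on_bounded_linear:
  "open S \<Longrightarrow> bounded_linear L \<Longrightarrow> smooth_on S f \<Longrightarrow> smooth_on S (\<lambda>x. L (f x))"
  by (simp add: smooth_on_def ck_on_bounded_linear)

lemma smooth_on_add:
  "open S \<Longrightarrow> smooth_on S f \<Longrightarrow> smooth_on S g \<Longrightarrow> smooth_on S (\<lambda>x. f x + g x)"
  by (simp add: smooth_on_def ck_on_add)

lemma smooth_on_sum:
  "open S \<Longrightarrow> (\<And>i. i \<in> I \<Longrightarrow> smooth_on S (f i)) \<Longrightarrow> smooth_on S (\<lambda>x. \<Sum>i\<in>I. f i x)"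
  by (simp add: smooth_on_def ck_on_sum)

lemma smooth_on_compose:
  fixes g :: "'a::euclidean_space \<Rightarrow> 'b::euclidean_space" and f :: "'b \<Rightarrow> 'c::real_normed_vector"
  shows "open S \<Longrightarrow> g ` S \<subseteq> R \<Longrightarrow> smooth_on S g \<Longrightarrow> smooth_on R f \<Longrightarrow> smooth_on S (\<lambda>x. f (g x))"
  by (simp add: smooth_on_def ck_on_compose[of S g R])

lemma smooth_on_frechet_derivative:
  "smooth_on S f \<Longrightarrow> smooth_on S (\<lambda>x. frechet_derivative f (at x) v)"
  unfolding smooth_on_def
proof
  fix k assume "\<forall>k. ck_on k S f"
  then have "ck_on (Suc k) S f" by blast
  then show "ck_on k S (\<lambda>x. frechet_derivative f (at x) v)" by simp
qed

lemma smooth_on_differentiable: "smooth_on S f \<Longrightarrow> x \<in> S \<Longrightarrow> f differentiable (at x)"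
  unfolding smooth_on_def by (auto dest: spec[of _ "Suc 0"])

lemma smooth_on_continuous_on: "smooth_on S f \<Longrightarrow> continuous_on S f"
  unfolding smooth_on_def by (auto dest: spec[of _ 0])

text \<open>Holomorphic maps are described by components, transition maps are used as vector valued
  maps. The vector is the sum of its components placed on the axes, so boundedness of
  \<open>axis j\<close> is what has to be checked.\<close>

lemma smooth_on_vec:
  fixes f :: "'a::euclidean_space \<Rightarrow> 'b::real_normed_vector ^ 'n"
  assumes "open S" "\<And>j. smooth_on S (\<lambda>x. f x $ j)"
  shows "smooth_on S f"
proof -
  have "bounded_linear (axis j :: 'b \<Rightarrow> 'b^'n)" for j
  proof (rule bounded_linear_intro[where K=1])
    show "norm (axis j x :: 'b^'n) \<le> norm x * 1" for x
    proof -
      have "norm (axis j x :: 'b^'n) \<le> (\<Sum>i\<in>UNIV. norm ((axis j x :: 'b^'n) $ i))"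
        unfolding norm_vec_def by (rule L2_set_le_sum) auto
      also have "\<dots> = (\<Sum>i\<in>UNIV. if i = j then norm x else 0)"
        by (rule sum.cong) (auto simp: axis_def)
      finally show ?thesis by simp
    qed
  qed (auto simp: axis_def vec_eq_iff)
  then have "smooth_on S (\<lambda>x. \<Sum>j\<in>UNIV. axis j (f x $ j))"
    using assms by (intro smooth_on_sum smooth_on_bounded_linear[of S "axis _"])
  moreover have "(\<Sum>j\<in>UNIV. axis j (f x $ j)) = f x" for x
    by (simp add: vec_eq_iff axis_def if_distrib[of "\<lambda>g. g _"] cong: if_cong)
  ultimately show ?thesis by simp
qed

section \<open>Symmetry of second derivatives\<close>

text \<open>The mean value theorem is used twice: along \<open>v\<close> for the increment of
  \<open>f\<close> in direction \<open>w\<close>, and along \<open>w\<close> for the derivative of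
  \<open>f\<close> in direction \<open>v\<close>.\<close>

lemma mixed_difference:
  fixes f :: "'a::euclidean_space \<Rightarrow> real"
  assumes "smooth_on S f" "\<And>a b. a \<in> {0..1} \<Longrightarrow> b \<in> {0..1} \<Longrightarrow> x + a *\<^sub>R v + b *\<^sub>R w \<in> S"
  obtains a b where "a \<in> {0..1}" "b \<in> {0..1}"
    "f (x + v + w) - f (x + v) - f (x + w) + f x =
      frechet_derivative (\<lambda>y. frechet_derivative f (at y) v) (at (x + a *\<^sub>R v + b *\<^sub>R w)) w"
proof -
  have line: "((\<lambda>t. y + t *\<^sub>R z) has_derivative (\<lambda>t. t *\<^sub>R z)) (at t)" for y z :: 'a and t
    by (auto intro!: derivative_eq_intros)
  have D: "((\<lambda>t. h (y + t *\<^sub>R z)) has_real_derivative frechet_derivative h (at (y + t *\<^sub>R z)) z) (at t)"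
    if "h differentiable (at (y + t *\<^sub>R z))" for h :: "'a \<Rightarrow> real" and y z t
    using has_derivative_at_compose[OF line has_derivative_frechet[OF that]]
      linear_scale[OF linear_frechet_derivative[OF that]]
    by (simp add: has_field_derivative_def mult.commute[of _ "frechet_derivative h _ z"])
  have f: "f differentiable (at y)" if "y \<in> S" for y
    using assms(1) that by (rule smooth_on_differentiable)
  have f': "(\<lambda>y. frechet_derivative f (at y) v) differentiable (at y)" if "y \<in> S" for y
    using smooth_on_frechet_derivative[OF assms(1)] that by (rule smooth_on_differentiable)
  \<comment> \<open>\<open>?h 1 - ?h 0\<close> is the second difference of the conclusion.\<close>
  let ?h = "\<lambda>a. f ((x + w) + a *\<^sub>R v) - f (x + a *\<^sub>R v)"
  have h: "(?h has_real_derivative (frechet_derivative f (at ((x + w) + a *\<^sub>R v)) v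
      - frechet_derivative f (at (x + a *\<^sub>R v)) v)) (at a)" if "0 \<le> a" "a \<le> 1" for a
    using assms(2)[of a 1] assms(2)[of a 0] that
    by (intro DERIV_diff D f) (auto simp: algebra_simps)
  obtain a where a: "0 < a" "a < 1" "?h 1 - ?h 0 = frechet_derivative f (at ((x + w) + a *\<^sub>R v)) v
      - frechet_derivative f (at (x + a *\<^sub>R v)) v"
    using MVT2[of 0 1 ?h, OF _ h] by auto
  let ?k = "\<lambda>b. frechet_derivative f (at ((x + a *\<^sub>R v) + b *\<^sub>R w)) v"
  have k: "(?k has_real_derivative
      frechet_derivative (\<lambda>y. frechet_derivative f (at y) v) (at ((x + a *\<^sub>R v) + b *\<^sub>R w)) w) (at b)"
    if "0 \<le> b" "b \<le> 1" for b
    by (rule D, rule f', rule assms(2)) (use a that in auto)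
  obtain b where b: "0 < b" "b < 1" "?k 1 - ?k 0 =
      frechet_derivative (\<lambda>y. frechet_derivative f (at y) v) (at ((x + a *\<^sub>R v) + b *\<^sub>R w)) w"
    using MVT2[of 0 1 ?k, OF _ k] by auto
  show thesis
    by (rule that[of a b]) (use a b in \<open>auto simp: algebra_simps\<close>)
qed

text \<open>The second difference over a parallelogram does not change when its sides are exchanged.
  Hence the two mixed derivatives agree at two possibly different points of a small parallelogram at
  \<open>x\<close>, and continuity brings both points to \<open>x\<close>.\<close>

lemma second_derivative_symmetric_real:
  fixes f :: "'a::euclidean_space \<Rightarrow> real"
  assumes "open S" "x \<in> S" "smooth_on S f"
  shows "frechet_derivative (\<lambda>y. frechet_derivative f (at y) v) (at x) w =
    frechet_derivative (\<lambda>y. frechet_derivative f (at y) w) (at x) v"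
proof -
  define Q where "Q v w y = frechet_derivative (\<lambda>y. frechet_derivative f (at y) v) (at y) w" for v w y
  \<comment> \<open>Homogeneity in both directions, so that the squared side factor of the shrunken
    parallelogram can be cancelled.\<close>
  have scale: "Q (s *\<^sub>R v) (t *\<^sub>R w) y = s * t * Q v w y" if "y \<in> S" for s t v w y
  proof -
    have d: "(\<lambda>y. frechet_derivative f (at y) v) differentiable (at y)"
      using smooth_on_frechet_derivative[OF assms(3)] that by (rule smooth_on_differentiable)
    have "frechet_derivative (\<lambda>y. frechet_derivative f (at y) (s *\<^sub>R v)) (at y) =
        frechet_derivative (\<lambda>y. s *\<^sub>R frechet_derivative f (at y) v) (at y)"
      by (rule frechet_derivative_cong_open[OF assms(1) that])
        (rule linear_scale[OF linear_frechet_derivative[OF smooth_on_differentiable[OF assms(3)]]])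
    also have "\<dots> = (\<lambda>w. s *\<^sub>R frechet_derivative (\<lambda>y. frechet_derivative f (at y) v) (at y) w)"
      by (rule frechet_derivative_at[symmetric])
        (intro has_derivative_scaleR_right has_derivative_frechet d)
    finally show ?thesis
      unfolding Q_def by (simp add: linear_scale[OF linear_frechet_derivative[OF d]])
  qed
  have cont: "isCont (Q v w) x" for v w
    using smooth_on_continuous_on[OF smooth_on_frechet_derivative[OF smooth_on_frechet_derivative[OF assms(3)]]]
      assms(1,2) unfolding Q_def by (simp add: continuous_on_eq_continuous_at)
  have "\<bar>Q v w x - Q w v x\<bar> \<le> e" if "0 < e" for e
  proof -
    have "0 < e / 2" using that by simp
    then have "eventually (\<lambda>y. \<bar>Q v w y - Q v w x\<bar> < e / 2) (at x)"
      "eventually (\<lambda>y. \<bar>Q w v y - Q w v x\<bar> < e / 2) (at x)"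
      using tendstoD[OF cont[of v w, unfolded isCont_def], of "e / 2"]
        tendstoD[OF cont[of w v, unfolded isCont_def], of "e / 2"]
      by (simp_all add: dist_real_def)
    then have "eventually (\<lambda>y. \<bar>Q v w y - Q v w x\<bar> < e / 2 \<and> \<bar>Q w v y - Q w v x\<bar> < e / 2) (at x)"
      by (rule eventually_conj)
    then obtain d1 where d1: "0 < d1" "\<And>y. y \<noteq> x \<Longrightarrow> dist y x < d1 \<Longrightarrow>
        \<bar>Q v w y - Q v w x\<bar> < e / 2 \<and> \<bar>Q w v y - Q w v x\<bar> < e / 2"
      unfolding eventually_at by blast
    obtain d2 where d2: "0 < d2" "ball x d2 \<subseteq> S"
      using assms(1,2) open_contains_ball by blast
    define d where "d = min d1 d2"
    have "0 < d" using d1(1) d2(1) by (simp add: d_def)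
    have d: "y \<in> S" "\<bar>Q v w y - Q v w x\<bar> < e / 2" "\<bar>Q w v y - Q w v x\<bar> < e / 2"
      if "dist x y < d" for y
      using that d1(2)[of y] d2(2) \<open>0 < e\<close>
      by (cases "y = x"; auto simp: d_def dist_commute subset_iff)+
    \<comment> \<open>The sides \<open>t *\<^sub>R v\<close> and \<open>t *\<^sub>R w\<close> have
      total length less than \<open>d\<close>; the summand 1 makes this strict and keeps the
      quotient meaningful when both vectors vanish.\<close>
    define t where "t = d / (norm v + norm w + 1)"
    have pos: "0 < norm v + norm w + 1" by (simp add: add_nonneg_pos)
    have "0 < t" using \<open>0 < d\<close> pos by (simp add: t_def)
    have near: "dist x (x + a *\<^sub>R (t *\<^sub>R v) + b *\<^sub>R (t *\<^sub>R w)) < d"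
      if "a \<in> {0..1}" "b \<in> {0..1}" for a b
    proof -
      have "norm (a *\<^sub>R (t *\<^sub>R v) + b *\<^sub>R (t *\<^sub>R w)) \<le> a * t * norm v + b * t * norm w"
        using norm_triangle_ineq[of "a *\<^sub>R (t *\<^sub>R v)" "b *\<^sub>R (t *\<^sub>R w)"] that \<open>0 < t\<close> by simp
      also have "\<dots> \<le> 1 * t * norm v + 1 * t * norm w"
        using that \<open>0 < t\<close> by (intro add_mono mult_right_mono) auto
      also have "\<dots> < t * (norm v + norm w + 1)"
        using \<open>0 < t\<close> by (simp add: algebra_simps)
      also have "\<dots> = d" using pos by (simp add: t_def)
      finally show ?thesis
        by (subst dist_commute) (simp only: dist_norm add.assoc add_diff_cancel_left')
    qed
    obtain a b where ab: "a \<in> {0..1}" "b \<in> {0..1}"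
      "f (x + t *\<^sub>R v + t *\<^sub>R w) - f (x + t *\<^sub>R v) - f (x + t *\<^sub>R w) + f x =
        Q (t *\<^sub>R v) (t *\<^sub>R w) (x + a *\<^sub>R (t *\<^sub>R v) + b *\<^sub>R (t *\<^sub>R w))"
      using mixed_difference[OF assms(3) d(1)[OF near]] unfolding Q_def by blast
    have near': "dist x (x + a *\<^sub>R (t *\<^sub>R w) + b *\<^sub>R (t *\<^sub>R v)) < d"
      if "a \<in> {0..1}" "b \<in> {0..1}" for a b
      using near[OF that(2,1)] by (simp only: add.assoc add.commute[of "a *\<^sub>R (t *\<^sub>R w)"])
    obtain a' b' where ab': "a' \<in> {0..1}" "b' \<in> {0..1}"
      "f (x + t *\<^sub>R w + t *\<^sub>R v) - f (x + t *\<^sub>R w) - f (x + t *\<^sub>R v) + f x =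
        Q (t *\<^sub>R w) (t *\<^sub>R v) (x + a' *\<^sub>R (t *\<^sub>R w) + b' *\<^sub>R (t *\<^sub>R v))"
      using mixed_difference[OF assms(3) d(1)[OF near']] unfolding Q_def by blast
    define y where "y = x + a *\<^sub>R (t *\<^sub>R v) + b *\<^sub>R (t *\<^sub>R w)"
    define y' where "y' = x + a' *\<^sub>R (t *\<^sub>R w) + b' *\<^sub>R (t *\<^sub>R v)"
    have y: "dist x y < d" "dist x y' < d"
      unfolding y_def y'_def by (rule near[OF ab(1,2)], rule near'[OF ab'(1,2)])
    have "Q (t *\<^sub>R v) (t *\<^sub>R w) y = Q (t *\<^sub>R w) (t *\<^sub>R v) y'"
      using ab(3) ab'(3) unfolding y_def y'_def by (simp add: add_ac)
    then have "Q v w y = Q w v y'"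
      using scale[OF d(1)[OF y(1)]] scale[OF d(1)[OF y(2)]] \<open>0 < t\<close> by simp
    then show ?thesis using d(2)[OF y(1)] d(3)[OF y(2)] by linarith
  qed
  then have "\<bar>Q v w x - Q w v x\<bar> \<le> 0" by (rule field_le_epsilon) simp
  then show ?thesis by (simp add: Q_def)
qed

lemma second_derivative_symmetric:
  fixes f :: "'a::euclidean_space \<Rightarrow> 'b::euclidean_space"
  assumes "open S" "x \<in> S" "smooth_on S f"
  shows "frechet_derivative (\<lambda>y. frechet_derivative f (at y) v) (at x) w =
    frechet_derivative (\<lambda>y. frechet_derivative f (at y) w) (at x) v"
proof (rule euclidean_eqI)
  fix b :: 'b
  have inner: "frechet_derivative (\<lambda>y. h y \<bullet> b) (at y) u = frechet_derivative h (at y) u \<bullet> b"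
    if "h differentiable (at y)" for h :: "'a \<Rightarrow> 'b" and y u
    by (simp add: frechet_derivative_at[OF has_derivative_inner_left[OF has_derivative_frechet[OF that]], symmetric])
  have sm: "smooth_on S (\<lambda>y. f y \<bullet> b)"
    by (rule smooth_on_bounded_linear[OF assms(1) bounded_linear_inner_left assms(3)])
  have "frechet_derivative (\<lambda>y. frechet_derivative (\<lambda>y. f y \<bullet> b) (at y) u) (at x) z =
      frechet_derivative (\<lambda>y. frechet_derivative f (at y) u) (at x) z \<bullet> b" for u z
  proof -
    have "frechet_derivative (\<lambda>y. frechet_derivative (\<lambda>y. f y \<bullet> b) (at y) u) (at x) =
        frechet_derivative (\<lambda>y. frechet_derivative f (at y) u \<bullet> b) (at x)"
      by (rule frechet_derivative_cong_open[OF assms(1,2)])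
        (rule inner[OF smooth_on_differentiable[OF assms(3)]])
    then show ?thesis
      by (simp only:) (rule inner[OF smooth_on_differentiable[OF smooth_on_frechet_derivative[OF assms(3)] assms(2)]])
  qed
  then show "frechet_derivative (\<lambda>y. frechet_derivative f (at y) v) (at x) w \<bullet> b =
      frechet_derivative (\<lambda>y. frechet_derivative f (at y) w) (at x) v \<bullet> b"
    using second_derivative_symmetric_real[OF assms(1,2) sm, of v w] by simp
qed

section \<open>Product rule for fields of linear maps, and 1-forms pulled back in
  coordinates\<close>

text \<open>Linearity in the first argument reduces \<open>F\<close> to the finitely many functions
  \<open>F b\<close> with \<open>b\<close> in \<open>Basis\<close>. So differentiability for each
  fixed \<open>k\<close> suffices, and the claim is the ordinary product rule term by term.\<close>

lemma has_derivative_linear_family: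
  fixes F :: "'c::euclidean_space \<Rightarrow> 'a::euclidean_space \<Rightarrow> 'b::real_normed_vector"
  assumes "open N" "x \<in> N" "\<And>y. y \<in> N \<Longrightarrow> linear (\<lambda>k. F k y)"
    and F: "\<And>k. F k differentiable (at x)" and w: "w differentiable (at x)"
  shows "((\<lambda>y. F (w y) y) has_derivative
    (\<lambda>v. F (frechet_derivative w (at x) v) x + frechet_derivative (F (w x)) (at x) v)) (at x)"
proof -
  have expand: "F k y = (\<Sum>b\<in>Basis. (k \<bullet> b) *\<^sub>R F b y)" if "y \<in> N" for k y
    by (rule linear_expand_Basis[OF assms(3)[OF that]])
  \<comment> \<open>With the coefficients frozen at \<open>w x\<close>, this computes the derivative
    of the single function \<open>F (w x)\<close>, the second term of the claim.\<close>
  have "((\<lambda>y. \<Sum>b\<in>Basis. (w x \<bullet> b) *\<^sub>R F b y) has_derivative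
      (\<lambda>v. \<Sum>b\<in>Basis. (w x \<bullet> b) *\<^sub>R frechet_derivative (F b) (at x) v)) (at x)"
    by (intro has_derivative_sum has_derivative_scaleR_right has_derivative_frechet F)
  then have "(F (w x) has_derivative
      (\<lambda>v. \<Sum>b\<in>Basis. (w x \<bullet> b) *\<^sub>R frechet_derivative (F b) (at x) v)) (at x)"
    by (rule has_derivative_transform_within_open[OF _ assms(1,2)]) (rule expand[symmetric])
  from frechet_derivative_at[OF this]
  have Fw: "frechet_derivative (F (w x)) (at x) v =
      (\<Sum>b\<in>Basis. (w x \<bullet> b) *\<^sub>R frechet_derivative (F b) (at x) v)" for v by (simp add: fun_eq_iff)
  have "((\<lambda>y. \<Sum>b\<in>Basis. (w y \<bullet> b) *\<^sub>R F b y) has_derivative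
      (\<lambda>v. \<Sum>b\<in>Basis. (w x \<bullet> b) *\<^sub>R frechet_derivative (F b) (at x) v
        + (frechet_derivative w (at x) v \<bullet> b) *\<^sub>R F b x)) (at x)"
    by (intro has_derivative_sum has_derivative_scaleR has_derivative_inner_left has_derivative_frechet F w)
  also have "(\<lambda>v. \<Sum>b\<in>Basis. (w x \<bullet> b) *\<^sub>R frechet_derivative (F b) (at x) v
        + (frechet_derivative w (at x) v \<bullet> b) *\<^sub>R F b x) =
      (\<lambda>v. F (frechet_derivative w (at x) v) x + frechet_derivative (F (w x)) (at x) v)"
    by (simp add: Fw expand[OF assms(2), of "frechet_derivative w (at x) _"] sum.distrib add.commute)
  finally show ?thesis
    by (rule has_derivative_transform_within_open[OF _ assms(1,2)]) (rule expand[symmetric])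
qed

text \<open>The derivative of \<open>a(\<phi>\<^sub>* \<zeta>)\<close> along \<open>\<phi>\<close> for a 1-form \<open>a\<close> and a vector field \<open>\<zeta>\<close>. The middle term is
  symmetric in \<open>v\<close> and \<open>\<zeta> x\<close>; this is why it cancels in the exterior derivative.\<close>

lemma frechet_derivative_pullback_form:
  fixes \<phi> :: "'a::euclidean_space \<Rightarrow> 'c::euclidean_space"
    and a :: "'c \<Rightarrow> 'c \<Rightarrow> 'b::real_normed_vector"
  assumes "open N" "x \<in> N" "smooth_on N \<phi>" "smooth_on N \<zeta>" "\<phi> ` N \<subseteq> R"
    and "\<And>k. smooth_on R (a k)" "\<And>y. y \<in> R \<Longrightarrow> linear (\<lambda>k. a k y)"
  shows "frechet_derivative (\<lambda>y. a (frechet_derivative \<phi> (at y) (\<zeta> y)) (\<phi> y)) (at x) v =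
    a (frechet_derivative \<phi> (at x) (frechet_derivative \<zeta> (at x) v)) (\<phi> x)
    + a (frechet_derivative (\<lambda>y. frechet_derivative \<phi> (at y) (\<zeta> x)) (at x) v) (\<phi> x)
    + frechet_derivative (a (frechet_derivative \<phi> (at x) (\<zeta> x))) (at (\<phi> x)) (frechet_derivative \<phi> (at x) v)"
proof -
  let ?w = "\<lambda>y. frechet_derivative \<phi> (at y) (\<zeta> y)"
  have \<phi>: "\<phi> differentiable (at y)" if "y \<in> N" for y
    using assms(3) that by (rule smooth_on_differentiable)
  have a: "a k differentiable (at (\<phi> x))" for k
    using assms(2,5) by (intro smooth_on_differentiable[OF assms(6)]) auto
  \<comment> \<open>The product rule enters at two levels: here for the differential of
    \<open>\<phi>\<close> applied to the moving vector \<open>\<zeta> y\<close>, and in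
    \<open>aw\<close> for the form applied to the resulting vector \<open>?w y\<close>.\<close>
  have w: "(?w has_derivative (\<lambda>v. frechet_derivative \<phi> (at x) (frechet_derivative \<zeta> (at x) v)
      + frechet_derivative (\<lambda>y. frechet_derivative \<phi> (at y) (\<zeta> x)) (at x) v)) (at x)"
    using linear_frechet_derivative[OF \<phi>]
      smooth_on_differentiable[OF smooth_on_frechet_derivative[OF assms(3)] assms(2)]
      smooth_on_differentiable[OF assms(4,2)]
    by (rule has_derivative_linear_family[OF assms(1,2), of "\<lambda>k y. frechet_derivative \<phi> (at y) k"])
  have a\<phi>: "((\<lambda>y. a k (\<phi> y)) has_derivative
      (\<lambda>v. frechet_derivative (a k) (at (\<phi> x)) (frechet_derivative \<phi> (at x) v))) (at x)" for k
    by (rule has_derivative_at_compose[OF has_derivative_frechet[OF \<phi>[OF assms(2)]] has_derivative_frechet[OF a]])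
  have lin: "linear (\<lambda>k. a k (\<phi> y))" if "y \<in> N" for y
    using assms(5,7) that by blast
  have aw: "((\<lambda>y. a (?w y) (\<phi> y)) has_derivative
      (\<lambda>v. a (frechet_derivative ?w (at x) v) (\<phi> x)
        + frechet_derivative (\<lambda>y. a (?w x) (\<phi> y)) (at x) v)) (at x)"
    using a\<phi> w
    by (intro has_derivative_linear_family[OF assms(1,2), of "\<lambda>k y. a k (\<phi> y)"] lin)
      (auto simp: differentiable_def)
  show ?thesis
    by (simp add: frechet_derivative_at[OF aw, symmetric] frechet_derivative_at[OF w, symmetric]
        frechet_derivative_at[OF a\<phi>, symmetric] linear_add[OF lin[OF assms(2)]])
qed

section \<open>Charts and tangent vectors\<close>

lemma chart_inv_coord: "is_chart c \<Longrightarrow> p \<in> dom c \<Longrightarrow> chart_inv c (coord c p) = p"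
  unfolding is_chart_def homeomorphism_def by blast

lemma coord_chart_inv: "is_chart c \<Longrightarrow> x \<in> coord c ` dom c \<Longrightarrow> coord c (chart_inv c x) = x"
  unfolding is_chart_def homeomorphism_def by blast

lemma open_dom: "is_chart c \<Longrightarrow> open (dom c)"
  by (simp add: is_chart_def)

lemma open_coord_image:
  assumes "is_chart c" "open W"
  shows "open (coord c ` (dom c \<inter> W))"
proof -
  have "openin (top_of_set (coord c ` dom c)) (coord c ` (dom c \<inter> W))"
    using assms homeomorphism_imp_open_map[of "dom c" "coord c ` dom c" "coord c" "chart_inv c"]
    by (auto simp: is_chart_def openin_open_Int)
  then show ?thesis
    using assms(1) by (auto simp: is_chart_def elim: openin_open_trans)
qed

text \<open>Chain rule for a composition through a point of the manifold, where \<open>F\<close> and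
  \<open>h\<close> have derivatives only after a chart is inserted: near \<open>x\<close> the map
  \<open>F \<circ> h\<close> equals
  \<open>(F \<circ> chart_inv c) \<circ> (coord c \<circ> h)\<close>.\<close>

lemma frechet_derivative_through_chart:
  fixes c :: "('p::topological_space, 'e::euclidean_space) chart"
  assumes "is_chart c" "open N" "x \<in> N" "h ` N \<subseteq> dom c"
    and "(coord c \<circ> h) differentiable (at x)" "(F \<circ> chart_inv c) differentiable (at (coord c (h x)))"
  shows "frechet_derivative (F \<circ> h) (at x) v =
    frechet_derivative (F \<circ> chart_inv c) (at (coord c (h x))) (frechet_derivative (coord c \<circ> h) (at x) v)"
proof -
  have "frechet_derivative (F \<circ> h) (at x) v =
      frechet_derivative (\<lambda>y. (F \<circ> chart_inv c) ((coord c \<circ> h) y)) (at x) v"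
    using assms(4) by (intro fun_cong[OF frechet_derivative_cong_open[OF assms(2,3)]]) (auto simp: chart_inv_coord[OF assms(1)])
  also have "\<dots> = frechet_derivative (F \<circ> chart_inv c) (at (coord c (h x))) (frechet_derivative (coord c \<circ> h) (at x) v)"
    using assms(5,6) by (subst frechet_derivative_chain) (simp_all add: o_def)
  finally show ?thesis .
qed

text \<open>The underlying real smooth structure; the ambient manifold and the submanifold both
  become instances below.\<close>

locale smooth_manifold =
  fixes A :: "('p::topological_space, 'e::euclidean_space) chart set"
  assumes is_chart: "\<And>c. c \<in> A \<Longrightarrow> is_chart c"
    and cover: "(\<Union>c\<in>A. dom c) = UNIV"
    and transition_smooth: "\<And>c d. c \<in> A \<Longrightarrow> d \<in> A \<Longrightarrow>
      smooth_on (coord c ` (dom c \<inter> dom d)) (coord d \<circ> chart_inv c)"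
begin

lemma chart_at: "chart_at A p \<in> A" "p \<in> dom (chart_at A p)"
proof -
  have "\<exists>c. c \<in> A \<and> p \<in> dom c" using cover by blast
  from someI_ex[OF this] show "chart_at A p \<in> A" "p \<in> dom (chart_at A p)"
    by (simp_all add: chart_at_def)
qed

lemma transition_differentiable:
  assumes "c \<in> A" "d \<in> A" "p \<in> dom c" "p \<in> dom d"
  shows "(coord d \<circ> chart_inv c) differentiable (at (coord c p))"
  using smooth_on_differentiable[OF transition_smooth[OF assms(1,2)]] assms(3,4) by blast

lemma frechet_derivative_transition:
  assumes "c \<in> A" "d \<in> A" "e \<in> A" "p \<in> dom c" "p \<in> dom d" "p \<in> dom e"
  shows "frechet_derivative (coord e \<circ> chart_inv d) (at (coord d p))
      (frechet_derivative (coord d \<circ> chart_inv c) (at (coord c p)) v) =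
    frechet_derivative (coord e \<circ> chart_inv c) (at (coord c p)) v"
proof -
  have "frechet_derivative (coord e \<circ> chart_inv c) (at (coord c p)) v =
      frechet_derivative (coord e \<circ> chart_inv d) (at (coord d (chart_inv c (coord c p))))
        (frechet_derivative (coord d \<circ> chart_inv c) (at (coord c p)) v)"
  proof (rule frechet_derivative_through_chart[OF is_chart[OF assms(2)]])
    show "open (coord c ` (dom c \<inter> dom d))"
      by (intro open_coord_image open_dom is_chart assms(1,2))
    show "chart_inv c ` coord c ` (dom c \<inter> dom d) \<subseteq> dom d"
      by (auto simp: chart_inv_coord[OF is_chart[OF assms(1)]])
  qed (use assms in \<open>auto simp: chart_inv_coord[OF is_chart[OF assms(1)]] intro!: transition_differentiable\<close>)
  then show ?thesis
    using assms by (simp add: chart_inv_coord[OF is_chart[OF assms(1)]])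
qed

lemma frechet_derivative_transition_self:
  assumes "c \<in> A" "p \<in> dom c"
  shows "frechet_derivative (coord c \<circ> chart_inv c) (at (coord c p)) v = v"
proof -
  have "frechet_derivative (coord c \<circ> chart_inv c) (at (coord c p)) =
      frechet_derivative (\<lambda>x. x) (at (coord c p))"
    using assms is_chart[OF assms(1)]
    by (intro frechet_derivative_cong_open[of "coord c ` dom c"]) (auto simp: is_chart_def coord_chart_inv)
  then show ?thesis by simp
qed

lemma linear_components:
  assumes "c \<in> A" "p \<in> dom c"
  shows "linear (components A c p)"
proof -
  have "components A c p = frechet_derivative (coord c \<circ> chart_inv (chart_at A p)) (at (coord (chart_at A p) p))"
    by (simp add: components_def fun_eq_iff)
  then show ?thesis
    using assms chart_at[of p] by (simp only:) (intro linear_frechet_derivative transition_differentiable)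
qed

lemma components_chart_at: "components A (chart_at A p) p v = v"
  unfolding components_def by (rule frechet_derivative_transition_self[OF chart_at])

lemma field_rep_chart_at: "field_rep A (chart_at A p) X (coord (chart_at A p) p) = X p"
  by (simp add: field_rep_def chart_inv_coord[OF is_chart] chart_at components_chart_at)

lemma smooth_field_zero: "open W \<Longrightarrow> smooth_field A W (\<lambda>p. 0)"
  unfolding smooth_field_def
proof
  fix c assume W: "open W" and c: "c \<in> A"
  show "smooth_on (coord c ` (dom c \<inter> W)) (field_rep A c (\<lambda>p. 0))"
  proof (rule smooth_on_cong[OF open_coord_image[OF is_chart[OF c] W] _ smooth_on_const])
    show "0 = field_rep A c (\<lambda>p. 0) x" if "x \<in> coord c ` (dom c \<inter> W)" for x
      using that linear_0[OF linear_components[OF c]]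
      by (auto simp: field_rep_def chart_inv_coord[OF is_chart[OF c]])
  qed
qed

lemma smooth_field_add:
  assumes "open W" "smooth_field A W X" "smooth_field A W Y"
  shows "smooth_field A W (\<lambda>p. X p + Y p)"
  unfolding smooth_field_def
proof
  fix c assume c: "c \<in> A"
  have S: "open (coord c ` (dom c \<inter> W))" by (rule open_coord_image[OF is_chart[OF c] assms(1)])
  have "smooth_on (coord c ` (dom c \<inter> W)) (\<lambda>x. field_rep A c X x + field_rep A c Y x)"
    using assms c by (intro smooth_on_add[OF S]) (auto simp: smooth_field_def)
  then show "smooth_on (coord c ` (dom c \<inter> W)) (field_rep A c (\<lambda>p. X p + Y p))"
    using linear_add[OF linear_components[OF c]]
    by (elim smooth_on_cong[OF S, rotated]) (auto simp: field_rep_def chart_inv_coord[OF is_chart[OF c]])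
qed

lemma smooth_field_scaleR:
  assumes "open W" "smooth_field A W X"
  shows "smooth_field A W (\<lambda>p. r *\<^sub>R X p)"
  unfolding smooth_field_def
proof
  fix c assume c: "c \<in> A"
  have S: "open (coord c ` (dom c \<inter> W))" by (rule open_coord_image[OF is_chart[OF c] assms(1)])
  have "smooth_on (coord c ` (dom c \<inter> W)) (\<lambda>x. r *\<^sub>R field_rep A c X x)"
    using assms c by (intro smooth_on_bounded_linear[OF S bounded_linear_scaleR_right]) (auto simp: smooth_field_def)
  then show "smooth_on (coord c ` (dom c \<inter> W)) (field_rep A c (\<lambda>p. r *\<^sub>R X p))"
    using linear_scale[OF linear_components[OF c]]
    by (elim smooth_on_cong[OF S, rotated]) (auto simp: field_rep_def chart_inv_coord[OF is_chart[OF c]])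
qed

text \<open>On the domain \<open>W\<close> of a local frame, the values at \<open>p\<close> of
  sections of \<open>D\<close> form a subspace. It contains the frame vectors at \<open>p\<close>,
  hence their span \<open>D p\<close>.\<close>

lemma distribution_extend_vector:
  assumes "smooth_distribution A r D" "x \<in> D p"
  obtains W X where "open W" "p \<in> W" "smooth_field A W X" "\<And>q. q \<in> W \<Longrightarrow> X q \<in> D q" "X p = x"
proof -
  obtain W Z where W: "open W" "p \<in> W" and Z: "\<And>j. j < r \<Longrightarrow> smooth_field A W (Z j)"
    and D: "\<And>q. q \<in> W \<Longrightarrow> D q = span ((\<lambda>j. Z j q) ` {..<r})"
    using assms(1) unfolding smooth_distribution_def by metis
  let ?E = "{x. \<exists>X. smooth_field A W X \<and> (\<forall>q\<in>W. X q \<in> D q) \<and> X p = x}"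
  have "subspace ?E"
  proof (rule subspaceI)
    have "\<forall>q\<in>W. 0 \<in> D q" using D by (simp add: span_0)
    then show "0 \<in> ?E" using smooth_field_zero[OF W(1)] by auto
  next
    fix x y assume "x \<in> ?E" "y \<in> ?E"
    then obtain X Y where "smooth_field A W X" "smooth_field A W Y" "\<forall>q\<in>W. X q \<in> D q"
      "\<forall>q\<in>W. Y q \<in> D q" "X p = x" "Y p = y" by blast
    then show "x + y \<in> ?E"
      using D by (intro CollectI exI[of _ "\<lambda>q. X q + Y q"]) (simp add: smooth_field_add[OF W(1)] span_add)
  next
    fix r x assume "x \<in> ?E"
    then obtain X where "smooth_field A W X" "\<forall>q\<in>W. X q \<in> D q" "X p = x" by blast
    then show "r *\<^sub>R x \<in> ?E"
      using D by (intro CollectI exI[of _ "\<lambda>q. r *\<^sub>R X q"]) (simp add: smooth_field_scaleR[OF W(1)] span_scale)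
  qed
  moreover have "(\<lambda>j. Z j p) ` {..<r} \<subseteq> ?E"
  proof
    fix z assume "z \<in> (\<lambda>j. Z j p) ` {..<r}"
    then obtain j where "j < r" "z = Z j p" by auto
    then show "z \<in> ?E"
      using Z D by (intro CollectI exI[of _ "Z j"]) (auto intro: span_base)
  qed
  ultimately have "D p \<subseteq> ?E" by (simp only: D[OF W(2)] span_minimal)
  then obtain X where "smooth_field A W X" "\<forall>q\<in>W. X q \<in> D q" "X p = x" using assms(2) by blast
  then show thesis using that W by blast
qed

text \<open>A linear combination of the coordinate fields of \<open>c\<close>, with coefficients
  \<open>k\<close>. Tangent vectors at \<open>p\<close> are expressed in the preferred chart at
  \<open>p\<close>, hence the derivative of the transition map. Only points of \<open>dom c\<close>
  are meaningful.\<close>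

definition constant_field :: "('p, 'e) chart \<Rightarrow> 'e \<Rightarrow> 'p \<Rightarrow> 'e" where
  "constant_field c k p = frechet_derivative (coord (chart_at A p) \<circ> chart_inv c) (at (coord c p)) k"

lemma components_constant_field:
  assumes "c \<in> A" "d \<in> A" "p \<in> dom c" "p \<in> dom d"
  shows "components A d p (constant_field c k p) =
    frechet_derivative (coord d \<circ> chart_inv c) (at (coord c p)) k"
  unfolding components_def constant_field_def
  by (rule frechet_derivative_transition) (use assms chart_at in auto)

lemma constant_field_components:
  assumes "c \<in> A" "p \<in> dom c"
  shows "constant_field c (components A c p v) p = v"
  unfolding components_def constant_field_def
  by (subst frechet_derivative_transition)
    (use assms chart_at frechet_derivative_transition_self in auto)

lemma linear_constant_field:
  assumes "c \<in> A" "p \<in> dom c"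
  shows "linear (\<lambda>k. constant_field c k p)"
  using linear_frechet_derivative[OF transition_differentiable[OF assms(1) chart_at(1) assms(2) chart_at(2)]]
  unfolding constant_field_def by simp

lemma smooth_constant_field:
  assumes c: "c \<in> A"
  shows "smooth_field A (dom c) (constant_field c k)"
  unfolding smooth_field_def
proof
  fix d assume d: "d \<in> A"
  have S: "open (coord d ` (dom d \<inter> dom c))"
    by (intro open_coord_image open_dom is_chart c d)
  have "smooth_on (coord d ` (dom d \<inter> dom c))
      (\<lambda>x. frechet_derivative (coord d \<circ> chart_inv c) (at ((coord c \<circ> chart_inv d) x)) k)"
    by (rule smooth_on_compose[OF S _ transition_smooth[OF d c]
          smooth_on_frechet_derivative[OF transition_smooth[OF c d]]])
      (auto simp: chart_inv_coord[OF is_chart[OF d]])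
  then show "smooth_on (coord d ` (dom d \<inter> dom c)) (field_rep A d (constant_field c k))"
    by (elim smooth_on_cong[OF S, rotated])
      (auto simp: field_rep_def chart_inv_coord[OF is_chart[OF d]] components_constant_field[OF c d])
qed

lemma field_rep_constant_field:
  assumes "c \<in> A" "x \<in> coord c ` dom c"
  shows "field_rep A c (constant_field c k) x = k"
  using assms
  by (auto simp: field_rep_def chart_inv_coord[OF is_chart] components_constant_field
      frechet_derivative_transition_self)

text \<open>Coordinate fields commute. Here \<open>lie_bracket\<close> at \<open>p\<close> is
  computed in the very chart in which both fields have constant components.\<close>

lemma lie_bracket_constant_field:
  "lie_bracket A (constant_field (chart_at A p) k) (constant_field (chart_at A p) l) p = 0"
proof -
  let ?c = "chart_at A p"
  have "frechet_derivative (field_rep A ?c (constant_field ?c j)) (at (coord ?c p)) =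
      frechet_derivative (\<lambda>x. j) (at (coord ?c p))" for j
    using chart_at[of p] is_chart[OF chart_at(1)]
    by (intro frechet_derivative_cong_open[of "coord ?c ` dom ?c"])
      (auto simp: is_chart_def field_rep_constant_field)
  then show ?thesis by (simp add: lie_bracket_def Let_def)
qed

end

section \<open>Differentials of smooth maps and pullback of the exterior derivative\<close>

locale smooth_map = dom: smooth_manifold B + cod: smooth_manifold A
  for B :: "('q::topological_space, 'd::euclidean_space) chart set"
    and A :: "('p::topological_space, 'e::euclidean_space) chart set" +
  fixes f :: "'q \<Rightarrow> 'p"
  assumes continuous: "continuous_on UNIV f"
    and smooth: "\<And>b a. b \<in> B \<Longrightarrow> a \<in> A \<Longrightarrow>
      smooth_on (coord b ` (dom b \<inter> f -` dom a)) (coord a \<circ> f \<circ> chart_inv b)"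
begin

lemma open_vimage_map: "open W \<Longrightarrow> open (f -` W)"
  using continuous by (simp add: continuous_on_open_vimage)

lemma differentiable:
  assumes "b \<in> B" "a \<in> A" "q \<in> dom b" "f q \<in> dom a"
  shows "(coord a \<circ> f \<circ> chart_inv b) differentiable (at (coord b q))"
  using smooth_on_differentiable[OF smooth[OF assms(1,2)]] assms(3,4) by blast

lemma linear_tangent_map: "linear (tangent_map B A f q)"
proof -
  have "tangent_map B A f q = frechet_derivative (coord (chart_at A (f q)) \<circ> f \<circ> chart_inv (chart_at B q))
       (at (coord (chart_at B q) q))"
    by (simp add: tangent_map_def fun_eq_iff)
  then show ?thesis
    by (simp only:) (intro linear_frechet_derivative differentiable dom.chart_at cod.chart_at)
qed

text \<open>\<open>tangent_map\<close> changes its pair of charts from point to point. Changing the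
  chart in the target and in the source by the chain rule expresses it near a point in one fixed
  pair, as needed to differentiate it.\<close>

lemma components_tangent_map:
  assumes a: "a \<in> A" and b: "b \<in> B" and q: "q \<in> dom b" "f q \<in> dom a"
  shows "components A a (f q) (tangent_map B A f q v) =
    frechet_derivative (coord a \<circ> f \<circ> chart_inv b) (at (coord b q)) (components B b q v)"
proof -
  let ?b = "chart_at B q" and ?a = "chart_at A (f q)"
  note inv = chart_inv_coord[OF dom.is_chart]
  have "frechet_derivative (coord a \<circ> (f \<circ> chart_inv ?b)) (at (coord ?b q)) v =
      frechet_derivative (coord a \<circ> chart_inv ?a) (at (coord ?a ((f \<circ> chart_inv ?b) (coord ?b q))))
        (frechet_derivative (coord ?a \<circ> (f \<circ> chart_inv ?b)) (at (coord ?b q)) v)"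
  proof (rule frechet_derivative_through_chart[OF cod.is_chart[OF cod.chart_at(1)]])
    show "open (coord ?b ` (dom ?b \<inter> f -` dom ?a))"
      by (intro open_coord_image open_dom open_vimage_map dom.is_chart cod.is_chart dom.chart_at cod.chart_at)
    show "(f \<circ> chart_inv ?b) ` coord ?b ` (dom ?b \<inter> f -` dom ?a) \<subseteq> dom ?a"
      by (auto simp: inv dom.chart_at)
    show "(coord ?a \<circ> (f \<circ> chart_inv ?b)) differentiable at (coord ?b q)"
      using differentiable[OF dom.chart_at(1) cod.chart_at(1)] dom.chart_at cod.chart_at by (simp add: o_assoc)
    show "(coord a \<circ> chart_inv ?a) differentiable at (coord ?a ((f \<circ> chart_inv ?b) (coord ?b q)))"
      using cod.transition_differentiable[OF cod.chart_at(1) a cod.chart_at(2) q(2)] by (simp add: inv dom.chart_at)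
  qed (use dom.chart_at cod.chart_at in auto)
  moreover have "frechet_derivative ((coord a \<circ> f) \<circ> chart_inv ?b) (at (coord ?b q)) v =
      frechet_derivative ((coord a \<circ> f) \<circ> chart_inv b) (at (coord b (chart_inv ?b (coord ?b q))))
        (frechet_derivative (coord b \<circ> chart_inv ?b) (at (coord ?b q)) v)"
  proof (rule frechet_derivative_through_chart[OF dom.is_chart[OF b]])
    show "open (coord ?b ` (dom ?b \<inter> dom b))"
      by (intro open_coord_image open_dom dom.is_chart dom.chart_at b)
    show "chart_inv ?b ` coord ?b ` (dom ?b \<inter> dom b) \<subseteq> dom b"
      by (auto simp: inv dom.chart_at)
    show "(coord b \<circ> chart_inv ?b) differentiable at (coord ?b q)"
      using dom.transition_differentiable[OF dom.chart_at(1) b dom.chart_at(2) q(1)] .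
    show "((coord a \<circ> f) \<circ> chart_inv b) differentiable at (coord b (chart_inv ?b (coord ?b q)))"
      using differentiable[OF b a q] by (simp add: inv dom.chart_at)
  qed (use dom.chart_at q in auto)
  ultimately show ?thesis
    by (simp add: components_def tangent_map_def inv dom.chart_at o_assoc)
qed

text \<open>Since \<open>f\<^sub>* X\<close> is only a field along \<open>f\<close>, the ambient fields \<open>K\<close> and \<open>L\<close> are taken to be constant in a
  chart; the exterior derivative depends on their values at \<open>f q\<close> only.\<close>

lemma ext_deriv_pullback:
  fixes \<alpha> :: "'p \<Rightarrow> 'e \<Rightarrow> 'b::real_normed_vector"
  assumes \<alpha>: "smooth_form A Q \<alpha>" and Q: "open Q" "f q \<in> Q"
    and W: "open W" "q \<in> W" and XY: "smooth_field B W X" "smooth_field B W Y"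
  obtains W' K L where "open W'" "f q \<in> W'" "W' \<subseteq> Q" "smooth_field A W' K" "smooth_field A W' L"
    "K (f q) = tangent_map B A f q (X q)" "L (f q) = tangent_map B A f q (Y q)"
    "ext_deriv A \<alpha> K L (f q) = ext_deriv B (\<lambda>q v. \<alpha> (f q) (tangent_map B A f q v)) X Y q"
proof -
  define b c where "b = chart_at B q" and "c = chart_at A (f q)"
  have b: "b \<in> B" "q \<in> dom b" and c: "c \<in> A" "f q \<in> dom c"
    by (simp_all add: b_def c_def dom.chart_at cod.chart_at)
  have ch: "is_chart b" "is_chart c" using b c dom.is_chart cod.is_chart by auto
  define \<phi> where "\<phi> = coord c \<circ> f \<circ> chart_inv b"
  define N where "N = coord b ` (dom b \<inter> (W \<inter> f -` (dom c \<inter> Q)))"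
  define R where "R = coord c ` (dom c \<inter> Q)"
  \<comment> \<open>The coordinate expression of \<open>\<alpha>\<close> in \<open>c\<close>: its
    value on the field with constant components \<open>k\<close>, as a function of the
    coordinates.\<close>
  define a where "a k x = \<alpha> (chart_inv c x) (cod.constant_field c k (chart_inv c x))" for k x
  define x where "x = coord b q"
  have N: "open N" "x \<in> N"
    using W Q b c unfolding N_def x_def
    by (auto intro!: open_coord_image open_vimage_map ch open_dom)
  have \<phi>: "smooth_on N \<phi>"
    unfolding \<phi>_def N_def by (rule smooth_on_subset[OF smooth[OF b(1) c(1)]]) auto
  have \<phi>N: "\<phi> ` N \<subseteq> R"
    by (auto simp: \<phi>_def N_def R_def chart_inv_coord[OF ch(1)])
  have \<phi>x: "\<phi> x = coord c (f q)"
    by (simp add: \<phi>_def x_def chart_inv_coord[OF ch(1) b(2)])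
  define W' where "W' = dom c \<inter> Q"
  have W': "open W'" "f q \<in> W'" "W' \<subseteq> Q"
    using Q c open_dom[OF ch(2)] by (auto simp: W'_def)
  have const: "smooth_field A W' (cod.constant_field c k)" for k
    using cod.smooth_constant_field[OF c(1), of k] unfolding smooth_field_def W'_def
    by (auto elim!: ballE smooth_on_subset)
  have a_smooth: "smooth_on R (a k)" for k
  proof -
    have "smooth_fun A W' (\<lambda>p. \<alpha> p (cod.constant_field c k p))"
      using \<alpha> W' const unfolding smooth_form_def by blast
    then have "smooth_on (coord c ` (dom c \<inter> W')) ((\<lambda>p. \<alpha> p (cod.constant_field c k p)) \<circ> chart_inv c)"
      using c(1) unfolding smooth_fun_def by blast
    then show ?thesis by (simp add: R_def W'_def a_def[abs_def] o_def)
  qed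
  have a_linear: "linear (\<lambda>k. a k y)" if "y \<in> R" for y
  proof -
    have y: "chart_inv c y \<in> dom c" "chart_inv c y \<in> Q"
      using that by (auto simp: R_def chart_inv_coord[OF ch(2)])
    then have "linear (\<alpha> (chart_inv c y))" using \<alpha> by (simp add: smooth_form_def)
    then show ?thesis
      using linear_compose[OF cod.linear_constant_field[OF c(1) y(1)]] by (simp add: a_def o_def)
  qed
  have tangent: "tangent_map B A f q v = frechet_derivative \<phi> (at x) v" for v
    by (simp add: tangent_map_def \<phi>_def x_def b_def c_def)
  have at_fq: "cod.constant_field c k (f q) = k" for k
    using cod.constant_field_components[OF c, of k] by (simp add: c_def cod.components_chart_at)
  have a_at: "a k (\<phi> x) = \<alpha> (f q) k" for k
    by (simp add: a_def \<phi>x chart_inv_coord[OF ch(2) c(2)] at_fq)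
  \<comment> \<open>Brings the pulled back form into the shape required by
    \<open>frechet_derivative_pullback_form\<close>, on all of \<open>N\<close> and not only at
    \<open>x\<close>, since it is to be differentiated.\<close>
  have pull: "\<alpha> (f r) (tangent_map B A f r (Z r)) =
      a (frechet_derivative \<phi> (at y) (field_rep B b Z y)) (\<phi> y)"
    if "y \<in> N" "r = chart_inv b y" for Z y r
  proof -
    have r: "r \<in> dom b" "f r \<in> dom c" "coord b r = y"
      using that by (auto simp: N_def chart_inv_coord[OF ch(1)])
    have "frechet_derivative \<phi> (at y) (field_rep B b Z y) = components A c (f r) (tangent_map B A f r (Z r))"
      using components_tangent_map[OF c(1) b(1) r(1,2), of "Z r"] r(3) that(2)
      by (simp add: \<phi>_def field_rep_def)
    moreover have "chart_inv c (\<phi> y) = f r"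
      using chart_inv_coord[OF ch(2) r(2)] that(2) by (simp add: \<phi>_def)
    ultimately show ?thesis
      by (simp add: a_def cod.constant_field_components[OF c(1) r(2)])
  qed
  have rep: "smooth_on N (field_rep B b Z)" if "smooth_field B W Z" for Z
    using that b(1) unfolding smooth_field_def N_def by (auto elim!: ballE smooth_on_subset)
  have rep_x: "field_rep B b Z x = Z q" for Z
    by (simp add: b_def x_def dom.field_rep_chart_at)
  have deriv: "dirderiv B (\<lambda>r. \<alpha> (f r) (tangent_map B A f r (Z r))) q v =
      \<alpha> (f q) (frechet_derivative \<phi> (at x) (frechet_derivative (field_rep B b Z) (at x) v))
      + \<alpha> (f q) (frechet_derivative (\<lambda>y. frechet_derivative \<phi> (at y) (Z q)) (at x) v)
      + frechet_derivative (a (frechet_derivative \<phi> (at x) (Z q))) (at (\<phi> x)) (frechet_derivative \<phi> (at x) v)"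
    if "smooth_field B W Z" for Z v
  proof -
    have "dirderiv B (\<lambda>r. \<alpha> (f r) (tangent_map B A f r (Z r))) q v =
        frechet_derivative (\<lambda>y. a (frechet_derivative \<phi> (at y) (field_rep B b Z y)) (\<phi> y)) (at x) v"
      unfolding dirderiv_def b_def[symmetric] x_def[symmetric]
      by (rule fun_cong[OF frechet_derivative_cong_open[OF N]]) (simp add: pull)
    then show ?thesis
      by (simp add: frechet_derivative_pullback_form[OF N \<phi> rep[OF that] \<phi>N a_smooth a_linear] rep_x a_at)
  qed
  have deriv': "dirderiv A (\<lambda>p. \<alpha> p (cod.constant_field c k p)) (f q) v =
      frechet_derivative (a k) (at (\<phi> x)) v" for k v
    by (simp add: dirderiv_def c_def[symmetric] \<phi>x a_def[abs_def] o_def)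
  have \<alpha>_linear: "linear (\<alpha> (f q))" using \<alpha> Q by (simp add: smooth_form_def)
  define K where "K = cod.constant_field c (frechet_derivative \<phi> (at x) (X q))"
  define L where "L = cod.constant_field c (frechet_derivative \<phi> (at x) (Y q))"
  have bracket: "tangent_map B A f q (lie_bracket B X Y q) =
      frechet_derivative \<phi> (at x) (frechet_derivative (field_rep B b Y) (at x) (X q))
      - frechet_derivative \<phi> (at x) (frechet_derivative (field_rep B b X) (at x) (Y q))"
    by (simp add: lie_bracket_def Let_def b_def[symmetric] x_def[symmetric]
        linear_diff[OF linear_tangent_map] tangent)
  have "lie_bracket A K L (f q) = 0"
    unfolding K_def L_def c_def by (rule cod.lie_bracket_constant_field)
  then have "ext_deriv A \<alpha> K L (f q) = (1/2) *\<^sub>R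
      (frechet_derivative (a (frechet_derivative \<phi> (at x) (Y q))) (at (\<phi> x)) (frechet_derivative \<phi> (at x) (X q))
      - frechet_derivative (a (frechet_derivative \<phi> (at x) (X q))) (at (\<phi> x)) (frechet_derivative \<phi> (at x) (Y q)))"
    unfolding ext_deriv_def using linear_0[OF \<alpha>_linear] by (simp add: K_def L_def deriv' at_fq)
  \<comment> \<open>On M the derivatives have three terms each. Those with derivatives of the fields
    cancel against the bracket, those with second derivatives of \<open>\<phi>\<close> cancel by
    symmetry, and the derivatives of the coefficients of \<open>\<alpha>\<close> remain.\<close>
  also have "\<dots> = ext_deriv B (\<lambda>q v. \<alpha> (f q) (tangent_map B A f q v)) X Y q"
    unfolding ext_deriv_def bracket deriv[OF XY(1)] deriv[OF XY(2)]
      second_derivative_symmetric[OF N \<phi>, of "X q" "Y q"]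
    by (simp add: linear_diff[OF \<alpha>_linear])
  finally show thesis
    using W' const at_fq by (intro that[of W' K L]) (simp_all add: K_def L_def tangent)
qed

end

section \<open>Complex manifolds and holomorphic immersions as instances of the real theory\<close>

lemma holo_map_on_imp_smooth_on: "open S \<Longrightarrow> holo_map_on S f \<Longrightarrow> smooth_on S f"
  by (rule smooth_on_vec) (simp_all add: holo_map_on_def holo_on_def)

sublocale complex_manifold \<subseteq> smooth_manifold A
proof
  fix c d assume c: "c \<in> A" and d: "d \<in> A"
  have "open (coord c ` (dom c \<inter> dom d))"
    by (intro open_coord_image open_dom charts c d)
  then show "smooth_on (coord c ` (dom c \<inter> dom d)) (coord d \<circ> chart_inv c)"
    using charts_compatible[OF c d] by (simp add: holo_compatible_def holo_map_on_imp_smooth_on)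
qed (use charts charts_cover in auto)

sublocale complex_submanifold \<subseteq> smooth_map B A f
proof
  fix b a assume b: "b \<in> B" and a: "a \<in> A"
  have "open (f -` dom a)"
    using f_continuous open_dom[OF ambient.charts[OF a]] by (simp add: continuous_on_open_vimage)
  then have "open (coord b ` (dom b \<inter> f -` dom a))"
    by (rule open_coord_image[OF sub.charts[OF b]])
  then show "smooth_on (coord b ` (dom b \<inter> f -` dom a)) (coord a \<circ> f \<circ> chart_inv b)"
    using f_holomorphic[OF b a] by (rule holo_map_on_imp_smooth_on)
qed (rule f_continuous)

section \<open>The invariant distribution\<close>

lemma (in complex_almost_contact_metric_manifold) open_\<U>: "open (\<U> i)"
  using \<U>_coordinate[of i] open_dom by metis

text \<open>Invariance of the metric under J gives g(Jk, U) = g(JJk, JU), and JJ = -1 turns this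
  into g(k, -JU).\<close>

lemma (in complex_almost_contact_metric_manifold) v_eq:
  assumes "p \<in> \<U> i"
  shows "v i p k = g p k (V i p)"
proof -
  have bil: "bilinear (g p)" and J: "g p (cplx_J k) (cplx_J l) = g p k l" for k l
    using hermitian by (auto simp: hermitian_metric_def riemannian_metric_def)
  have JJ: "cplx_J (cplx_J k) = - k" for k :: "complex^'n"
    by (simp add: cplx_J_def vec_eq_iff)
  have "v i p k = g p (cplx_J (cplx_J k)) (cplx_J (U i p))"
    by (simp add: v_def metric_dual[OF assms] J)
  also have "\<dots> = g p k (V i p)"
    by (simp add: JJ V_def bilinear_lneg[OF bil] bilinear_rneg[OF bil])
  finally show ?thesis .
qed

context semi_invariant_submanifold
begin

lemma u_D: "f q \<in> \<U> i \<Longrightarrow> x \<in> D q \<Longrightarrow> u i (f q) (tangent_map B A f q x) = 0"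
  using orthogonal_UV[of q i "tangent_map B A f q x" "U i (f q)"]
  by (simp add: metric_dual push_distribution_def span_base)

lemma v_D: "f q \<in> \<U> i \<Longrightarrow> x \<in> D q \<Longrightarrow> v i (f q) (tangent_map B A f q x) = 0"
  using orthogonal_UV[of q i "tangent_map B A f q x" "V i (f q)"]
  by (simp add: v_eq push_distribution_def span_base)

text \<open>Applied to one vector at a time: \<open>x\<close> is tested against its image under G,
  and the exterior derivative of \<open>u i\<close> on this pair is minus the squared length of the
  image of \<open>x\<close>.\<close>

lemma involutive_imp_D_zero:
  assumes inv: "involutive B D" and x: "x \<in> D q"
  shows "x = 0"
proof -
  obtain i where i: "f q \<in> \<U> i" using \<U>_cover by blast
  let ?p = "f q" and ?x = "tangent_map B A f q x"
  have "?x \<in> push_distribution B A f D q" using x by (simp add: push_distribution_def)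
  then have "G i ?p ?x \<in> push_distribution B A f D q" using D_invariant[OF i] by blast
  \<comment> \<open>Only the value at \<open>q\<close> of the second field matters, so any section
    of \<open>D\<close> through \<open>y\<close> will do; it need not be G applied to the first
    field.\<close>
  then obtain y where y: "y \<in> D q" "G i ?p ?x = tangent_map B A f q y"
    by (auto simp: push_distribution_def)
  obtain r where r: "smooth_distribution B r D" using D_distribution by blast
  obtain W1 X where X: "open W1" "q \<in> W1" "smooth_field B W1 X" "\<And>q. q \<in> W1 \<Longrightarrow> X q \<in> D q" "X q = x"
    using sub.distribution_extend_vector[OF r x] by blast
  obtain W2 Y where Y: "open W2" "q \<in> W2" "smooth_field B W2 Y" "\<And>q. q \<in> W2 \<Longrightarrow> Y q \<in> D q" "Y q = y"
    using sub.distribution_extend_vector[OF r y(1)] by blast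
  define W where "W = W1 \<inter> W2 \<inter> f -` \<U> i"
  have W: "open W" "q \<in> W"
    using X Y i open_vimage_map[OF open_\<U>] by (auto simp: W_def)
  have XW: "smooth_field B W X" "smooth_field B W Y"
    using X(3) Y(3) unfolding smooth_field_def W_def by (auto elim!: ballE smooth_on_subset)
  have D: "X q' \<in> D q'" "Y q' \<in> D q'" "f q' \<in> \<U> i" if "q' \<in> W" for q'
    using that X(4) Y(4) by (auto simp: W_def)
  have "lie_bracket B X Y q \<in> D q"
    using inv W XW D unfolding involutive_def by blast
  then have "u i ?p (tangent_map B A f q (lie_bracket B X Y q)) = 0"
    by (rule u_D[OF i])
  \<comment> \<open>For sections of \<open>D\<close> the function vanishes on the whole of
    \<open>W\<close>, which was cut down to the preimage of \<open>\<U> i\<close> because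
    \<open>u i\<close> is local.\<close>
  moreover have "dirderiv B (\<lambda>q. u i (f q) (tangent_map B A f q (Z q))) q z = 0"
    if Z: "\<And>q'. q' \<in> W \<Longrightarrow> Z q' \<in> D q'" for Z z
  proof -
    let ?b = "chart_at B q"
    have b: "is_chart ?b" "q \<in> dom ?b" using sub.is_chart sub.chart_at by auto
    have "frechet_derivative ((\<lambda>q. u i (f q) (tangent_map B A f q (Z q))) \<circ> chart_inv ?b) (at (coord ?b q))
        = frechet_derivative (\<lambda>x. 0) (at (coord ?b q))"
      by (rule frechet_derivative_cong_open[OF open_coord_image[OF b(1) W(1)]])
        (use b W Z D u_D in \<open>auto simp: chart_inv_coord[OF b(1)]\<close>)
    then show ?thesis by (simp add: dirderiv_def)
  qed
  ultimately have zero: "ext_deriv B (\<lambda>q v. u i (f q) (tangent_map B A f q v)) X Y q = 0"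
    using D by (simp add: ext_deriv_def)
  obtain W' K L where "open W'" "?p \<in> W'" "W' \<subseteq> \<U> i" "smooth_field A W' K" "smooth_field A W' L"
    and KL: "K ?p = tangent_map B A f q (X q)" "L ?p = tangent_map B A f q (Y q)"
    and "ext_deriv A (u i) K L ?p = ext_deriv B (\<lambda>q v. u i (f q) (tangent_map B A f q v)) X Y q"
    by (rule ext_deriv_pullback[OF u_smooth open_\<U> i W XW])
  then have "g ?p (K ?p) (G i ?p (L ?p)) + wedge11 (\<sigma> i ?p) (v i ?p) (K ?p) (L ?p) = 0"
    using du[of W' i K L ?p] zero by simp
  moreover have "K ?p = ?x" "L ?p = G i ?p ?x"
    using KL X(5) Y(5) y(2) by simp_all
  \<comment> \<open>The first two equations remove the wedge term; the first and the third leave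
    only \<open>- ?x\<close> in \<open>G_square\<close>.\<close>
  moreover have "v i ?p ?x = 0" "v i ?p (G i ?p ?x) = 0" "u i ?p ?x = 0"
    using v_D[OF i x] v_D[OF i y(1)] u_D[OF i x] y(2) by simp_all
  ultimately have "g ?p ?x (- ?x) = 0"
    by (simp add: wedge11_def G_square[OF i])
  moreover have "bilinear (g ?p)" and pos: "?x \<noteq> 0 \<Longrightarrow> 0 < g ?p ?x ?x"
    using hermitian by (auto simp: hermitian_metric_def riemannian_metric_def)
  ultimately have "g ?p ?x ?x = 0" by (simp add: bilinear_rneg)
  then have "?x = 0" using pos by fastforce
  then show "x = 0"
    using injD[OF f_immersion, of q x 0] linear_0[OF linear_tangent_map] by simp
qed

end

theorem theorem5p5:
  fixes A :: "('p::{t2_space, second_countable_topology}, complex^'n) chart set"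
    and m :: nat
    and \<U> :: "'i \<Rightarrow> 'p set"
    and \<omega> :: "'i \<Rightarrow> 'p \<Rightarrow> complex^'n \<Rightarrow> complex"
    and g :: "'p \<Rightarrow> complex^'n \<Rightarrow> complex^'n \<Rightarrow> real"
    and nabla :: "('p \<Rightarrow> complex^'n) \<Rightarrow> 'p \<Rightarrow> complex^'n \<Rightarrow> complex^'n"
    and u :: "'i \<Rightarrow> 'p \<Rightarrow> complex^'n \<Rightarrow> real"
    and U :: "'i \<Rightarrow> 'p \<Rightarrow> complex^'n"
    and G :: "'i \<Rightarrow> 'p \<Rightarrow> complex^'n \<Rightarrow> complex^'n"
    and B :: "('q::{t2_space, second_countable_topology}, complex^'k) chart set"
    and f :: "'q \<Rightarrow> 'p"
    and D D' :: "'q \<Rightarrow> (complex^'k) set"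
  assumes "normal_complex_contact_metric_manifold A m \<U> \<omega> g nabla u U G"
    and "semi_invariant_submanifold A m \<U> \<omega> g nabla u U G B f D D'"
    and "\<forall>q. 0 < dim (D q)"
  shows "\<not> involutive B D"
proof
  assume "involutive B D"
  then have "D q \<subseteq> {0}" for q
    using semi_invariant_submanifold.involutive_imp_D_zero[OF assms(2)] by blast
  then have "dim (D q) = 0" for q by (simp only: dim_eq_0)
  then show False using assms(3) by (metis less_irrefl)
qed

end
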